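(* Let $\mathcal{M}$ be a (finite, triangulated) PL manifold with boundary $\partial\mathcal{M}$, of even dimension $d$. For a finite simplicial complex $K$ let $f_n(K)$ be the number of $n$-dimensional faces of $K$. Then $$\chi(\mathcal{M})=\sum_{n=0}^{d}\beta_n\left(f_n(\mathcal{M})-\tfrac12 f_n(\partial\mathcal{M})\right),$$ where $\beta_{n-2}=\dfrac{4(2^n-1)B_n}{n}$ for $n\ge 1$ and $B_n$ are the Bernoulli numbers.
   Context: For a finite simplicial complex $K$, $f_n(K)$ denotes the number of faces of dimension $n$ ($n\ge 0$), and the Euler characteristic is $\chi(K)=\sum_{n\ge 0}(-1)^n f_n(K)$. Here a PL manifold with boundary of dimension $d$ is a finite simplicial complex $\mathcal{M}$ in which the link of every vertex is a PL sphere or a PL ball of dimension $d-1$; its boundary $\partial\mathcal{M}$ is the subcomplex triangulating the boundary of the underlying manifold. The Bernoulli numbers $B_n$ are defined by $\frac{z}{e^z-1}=\sum_{n\ge 0}B_n\frac{z^n}{n!}$, so $B_1=-\tfrac12$. The sequence $\beta_n$ is indexed by $n\ge -1$; thus $\beta_{-1}=-2$, $\beta_0=1$, $\beta_2=-\tfrac12$, and $\beta_n=0$ for odd $n\ge 1$. *)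

theory Defs
  imports "HOL-Analysis.Analysis" "HOL-Computational_Algebra.Formal_Power_Series"
begin

text \<open>
  Finite simplicial complexes are those of \<^const>\<open>simplicial_complex\<close>: finite geometric
  complexes in a Euclidean space. They contain the empty simplex as soon as they are nonempty; it
  has dimension -1 and is therefore never counted below.
\<close>

definition f_num :: "nat \<Rightarrow> 'a::euclidean_space set set \<Rightarrow> nat" where
  "f_num n K = card {S \<in> K. int n simplex S}"

lemma f_num_eq_0:
  fixes K :: "'a::euclidean_space set set"
  assumes "n > DIM('a)"
  shows "f_num n K = 0"
proof -
  have False if "int n simplex S" for S :: "'a set"
    using aff_dim_simplex[OF that] aff_dim_le_DIM[of S] assms by simp
  then have "{S \<in> K. int n simplex S} = {}"
    by blast
  then show ?thesis
    unfolding f_num_def by (simp only: card.empty)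
qed

text \<open>
  By the preceding lemma, cutting the alternating sum off at the dimension of the ambient space
  loses nothing.
\<close>

definition euler_char :: "'a::euclidean_space set set \<Rightarrow> int" where
  "euler_char K = (\<Sum>n\<le>DIM('a). (-1) ^ n * int (f_num n K))"

text \<open>
  The empty simplex belongs to the link of every vertex, so the link of an isolated vertex is
  the complex \<open>{{}}\<close>.
\<close>

definition vertex_link :: "'a::euclidean_space set set \<Rightarrow> 'a \<Rightarrow> 'a set set" where
  "vertex_link K v = {T \<in> K. v \<notin> T \<and> (\<exists>S\<in>K. v \<in> S \<and> T face_of S)}"

definition affine_map_on ::
  "'a::euclidean_space set \<Rightarrow> ('a \<Rightarrow> 'b::euclidean_space) \<Rightarrow> bool" where
  "affine_map_on S f \<longleftrightarrow> (\<exists>h c. linear h \<and> (\<forall>x\<in>S. f x = h x + c))"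

definition piecewise_linear_on ::
  "'a::euclidean_space set \<Rightarrow> ('a \<Rightarrow> 'b::euclidean_space) \<Rightarrow> bool" where
  "piecewise_linear_on P f \<longleftrightarrow>
     (\<exists>\<T>. simplicial_complex \<T> \<and> \<Union>\<T> = P \<and> (\<forall>S\<in>\<T>. affine_map_on S f))"

definition pl_homeomorphic ::
  "'a::euclidean_space set \<Rightarrow> 'b::euclidean_space set \<Rightarrow> bool" where
  "pl_homeomorphic P Q \<longleftrightarrow>
     (\<exists>f g. homeomorphism P Q f g \<and> piecewise_linear_on P f \<and> piecewise_linear_on Q g)"

text \<open>
  Taking the model simplex in the ambient space of the complex is no restriction: an
  \<open>n\<close>-sphere does not embed in a Euclidean space of dimension less than \<open>n + 1\<close>. The sphere of
  dimension -1 is empty, as the relative frontier of a point is. There is no ball of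
  dimension -1, hence the nonnegativity condition (the empty set is a simplex of dimension -1).
\<close>

definition pl_sphere :: "int \<Rightarrow> 'a::euclidean_space set set \<Rightarrow> bool" where
  "pl_sphere n K \<longleftrightarrow> simplicial_complex K \<and>
     (\<exists>S::'a set. (n + 1) simplex S \<and> pl_homeomorphic (\<Union>K) (rel_frontier S))"

definition pl_ball :: "int \<Rightarrow> 'a::euclidean_space set set \<Rightarrow> bool" where
  "pl_ball n K \<longleftrightarrow> simplicial_complex K \<and> n \<ge> 0 \<and>
     (\<exists>S::'a set. n simplex S \<and> pl_homeomorphic (\<Union>K) S)"

definition pl_manifold :: "nat \<Rightarrow> 'a::euclidean_space set set \<Rightarrow> bool" where
  "pl_manifold d M \<longleftrightarrow> simplicial_complex M \<and>
     (\<forall>v. {v} \<in> M \<longrightarrow>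
        pl_sphere (int d - 1) (vertex_link M v) \<or> pl_ball (int d - 1) (vertex_link M v))"

text \<open>
  The boundary of a topological manifold with boundary of dimension \<open>d\<close>: the points that have no
  open neighbourhood homeomorphic to Euclidean \<open>d\<close>-space.
\<close>

definition manifold_boundary :: "nat \<Rightarrow> 'a::euclidean_space set \<Rightarrow> 'a set" where
  "manifold_boundary d X =
     {x \<in> X. \<not> (\<exists>U. openin (top_of_set X) U \<and> x \<in> U \<and>
                    top_of_set U homeomorphic_space Euclidean_space d)}"

definition boundary_complex :: "nat \<Rightarrow> 'a::euclidean_space set set \<Rightarrow> 'a set set" where
  "boundary_complex d M = {S \<in> M. S \<subseteq> manifold_boundary d (\<Union>M)}"

definition bernoulli :: "nat \<Rightarrow> real" where
  "bernoulli n = fact n * fps_nth (fps_X / (fps_exp 1 - 1)) n"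

lemma bernoulli_generating_function:
  "Abs_fps (\<lambda>n. bernoulli n / fact n) * (fps_exp 1 - 1) = fps_X"
proof -
  have nz: "fps_nth (fps_exp 1 - 1 :: real fps) 1 \<noteq> 0"
    by simp
  then have "fps_exp 1 - 1 \<noteq> (0 :: real fps)"
    by fastforce
  moreover from nz have "subdegree (fps_exp 1 - 1 :: real fps) \<le> 1"
    by (rule subdegree_leI)
  ultimately have "(fps_exp 1 - 1 :: real fps) dvd fps_X"
    by (simp add: fps_dvd_iff)
  then show ?thesis
    by (simp add: bernoulli_def fps_nth_inverse)
qed

end

theory Submission
  imports Defs
begin

text \<open>
  The sum of \<open>(-1)\<^sup>d\<^sup>i\<^sup>m\<close> over the cells of a polyhedral dissection that contain a point \<open>x\<close> depends
  only on the dissected set, because cutting a relatively open convex set by a hyperplane preserves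
  the alternating sum. In a closed star, the cone over the link, it may therefore be computed
  from a triangulation on which the homeomorphism of the link with the model sphere or ball is
  affine, and so on the image, where it is read off the faces of a simplex. The same
  homeomorphism, coned off, is a chart of the open star, and invariance of domain decides which
  points of the chart are boundary points. Hence for every nonempty face \<open>S\<close> the alternating sum
  over the faces containing \<open>S\<close> is \<open>(-1)\<^sup>d\<close> or \<open>0\<close> according to whether \<open>S\<close> is interior or lies in
  the boundary. Summing over the \<open>k\<close>-faces gives relations between the face
  numbers, which imply the formula because \<open>G(z) = -4 / (e\<^sup>z + 1)\<close>, the exponential generating
  function of \<open>n \<mapsto> \<beta> (n - 1)\<close>, satisfies \<open>e\<^sup>z G(z) = G(-z)\<close>.
\<close>

section \<open>The Euler characteristic of relatively open polyhedra\<close>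

text \<open>The triangulation on which the homeomorphism is affine is unrelated to the faces of the
  link, and its image is unrelated to the faces of the model. No common subdivision is built: the
  alternating sum over relatively open cells, an Euler characteristic with compact supports, is
  evaluated on one list of hyperplanes fine enough for both partitions. Coning raises every
  dimension by one, so local sums change sign away from the apex and become 1 minus the total sum of
  the base at the apex. The boundary is defined topologically, so a chart must accompany the count;
  over a ball link it is a cone that contains only part of its frontier, and the apex is a boundary
  point. On the numerical side, e^z G(z) = G(-z) says that the binomial matrix reproduces the
  numbers beta(n - 1) up to sign. Its column m = 0, with beta(-1) = -2, yields the constant 2, so
  the face relations, weighted by beta, add up to 2 chi - sum beta_k f_k = sum beta_k (f_k - b_k),
  with b_k counting boundary faces. Solving for chi produces the factor 1/2 at the boundary. The
  parity of d enters as (-1)^d = 1.\<close>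

primrec cell_euler :: "('a \<times> real) list \<Rightarrow> 'a::euclidean_space set \<Rightarrow> int" where
  "cell_euler [] S = (if S = {} then 0 else (-1) ^ nat (aff_dim S))"
| "cell_euler (h # hs) S =
     cell_euler hs (S \<inter> {x. fst h \<bullet> x < snd h}) + cell_euler hs (S \<inter> {x. fst h \<bullet> x = snd h})
     + cell_euler hs (S \<inter> {x. fst h \<bullet> x > snd h})"

text \<open>Every cell cut out of \<open>K\<close> by the hyperplanes \<open>hs\<close> is contained in or disjoint from \<open>S\<close>.\<close>

primrec resolves :: "('a \<times> real) list \<Rightarrow> 'a::euclidean_space set \<Rightarrow> 'a set \<Rightarrow> bool" where
  "resolves [] K S \<longleftrightarrow> K \<inter> S = {} \<or> K \<subseteq> S"
| "resolves (h # hs) K S \<longleftrightarrow>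
     resolves hs (K \<inter> {x. fst h \<bullet> x < snd h}) S \<and> resolves hs (K \<inter> {x. fst h \<bullet> x = snd h}) S
     \<and> resolves hs (K \<inter> {x. fst h \<bullet> x > snd h}) S"

text \<open>The empty set qualifies, so a cut may leave empty pieces without a case
  distinction.\<close>

definition rel_open_convex :: "'a::euclidean_space set \<Rightarrow> bool" where
  "rel_open_convex S \<longleftrightarrow> convex S \<and> openin (top_of_set (affine hull S)) S"

lemma rel_open_convex_Int_open:
  assumes "rel_open_convex S" "open U" "convex U"
  shows "rel_open_convex (S \<inter> U)"
    and "S \<inter> U \<noteq> {} \<Longrightarrow> aff_dim (S \<inter> U) = aff_dim S"
proof -
  have op: "openin (top_of_set (affine hull S)) (S \<inter> U)"
    using assms by (auto simp: rel_open_convex_def openin_Int_open)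
  have eq: "affine hull (S \<inter> U) = affine hull S" if "S \<inter> U \<noteq> {}"
    using affine_hull_openin[OF op that] .
  show "rel_open_convex (S \<inter> U)"
    using op eq assms by (cases "S \<inter> U = {}") (auto simp: rel_open_convex_def convex_Int)
  show "aff_dim (S \<inter> U) = aff_dim S" if "S \<inter> U \<noteq> {}"
    using eq[OF that] by (metis aff_dim_affine_hull)
qed

lemma rel_open_convex_Int_hyperplane:
  assumes "rel_open_convex S"
  shows "rel_open_convex (S \<inter> {x. a \<bullet> x = b})"
    and "S \<inter> {x. a \<bullet> x = b} \<noteq> {} \<Longrightarrow> \<not> S \<subseteq> {x. a \<bullet> x = b} \<Longrightarrow>
      aff_dim (S \<inter> {x. a \<bullet> x = b}) = aff_dim S - 1"
proof -
  let ?H = "{x. a \<bullet> x = b}"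
  have aff: "affine (affine hull S \<inter> ?H)"
    by (simp add: affine_Int affine_hyperplane)
  have "openin (top_of_set (affine hull S \<inter> ?H)) (S \<inter> ?H)"
    using assms openin_subtopology_Int
    by (metis (no_types, lifting) inf_commute openin_subtopology_Int2 rel_open_convex_def subtopology_subtopology)
  then have op: "openin (top_of_set (affine hull (affine hull S \<inter> ?H))) (S \<inter> ?H)"
    using aff by (simp add: hull_same)
  have eq: "affine hull (S \<inter> ?H) = affine hull S \<inter> ?H" if "S \<inter> ?H \<noteq> {}"
    using affine_hull_openin[OF op that] aff by (simp add: hull_same)
  have "openin (top_of_set (affine hull (S \<inter> ?H))) (S \<inter> ?H)"
    using op eq aff by (cases "S \<inter> ?H = {}") (auto simp: hull_same)
  then show "rel_open_convex (S \<inter> ?H)"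
    using assms by (simp add: rel_open_convex_def convex_Int convex_hyperplane)
  assume ne: "S \<inter> ?H \<noteq> {}" and ns: "\<not> S \<subseteq> ?H"
  have "affine hull S \<inter> ?H \<noteq> {}" "\<not> affine hull S \<subseteq> ?H"
    using ne ns hull_subset[of S affine] by blast+
  then have "aff_dim (affine hull S \<inter> ?H) = aff_dim (affine hull S) - 1"
    by (simp add: aff_dim_affine_Int_hyperplane)
  then show "aff_dim (S \<inter> ?H) = aff_dim S - 1"
    by (metis eq[OF ne] aff_dim_affine_hull)
qed

text \<open>The essential case is a hyperplane that meets \<open>S\<close> without containing it.
  Relative openness puts points of \<open>S\<close> strictly on both sides, and with n =
  \<open>aff_dim S\<close> the pieces contribute (-1)^n + (-1)^(n-1) + (-1)^n = (-1)^n.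
  Connectedness forbids two nonempty sides with an empty middle.\<close>

lemma cell_euler_Nil_split:
  assumes S: "rel_open_convex S"
  shows "cell_euler [] S = cell_euler [] (S \<inter> {x. a \<bullet> x < b}) + cell_euler [] (S \<inter> {x. a \<bullet> x = b})
    + cell_euler [] (S \<inter> {x. a \<bullet> x > b})"
proof -
  let ?L = "S \<inter> {x. a \<bullet> x < b}" and ?E = "S \<inter> {x. a \<bullet> x = b}" and ?G = "S \<inter> {x. a \<bullet> x > b}"
  have trich: "S = ?L \<union> ?E \<union> ?G" by force
  consider "?L = {}" "?E = {}" "?G = {}" | "S \<subseteq> {x. a \<bullet> x = b}" "S \<noteq> {}"
    | "?E = {}" "?L \<noteq> {} \<or> ?G \<noteq> {}" | "?E \<noteq> {}" "\<not> S \<subseteq> {x. a \<bullet> x = b}" by blast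
  then show ?thesis
  proof cases
    case 1
    then have "S = {}" using trich by simp
    then show ?thesis by simp
  next
    case 2
    then have "?L = {}" "?G = {}" "?E = S" by auto
    then show ?thesis by simp
  next
    case 3
    have "connected S"
      using S by (simp add: rel_open_convex_def convex_connected)
    then have "?L = {} \<or> ?G = {}"
      using 3(1) connected_ivt_hyperplane[of S _ _ a b] by fastforce
    with 3 have "?L = {} \<and> ?G = S \<or> ?G = {} \<and> ?L = S"
      using trich by (metis Un_empty_left Un_empty_right)
    with 3 show ?thesis by auto
  next
    case 4
    have dimE: "aff_dim ?E = aff_dim S - 1"
      using rel_open_convex_Int_hyperplane(2)[OF S 4] .
    obtain z where z: "z \<in> S" "a \<bullet> z = b" using 4 by auto
    obtain y where y: "y \<in> S" "a \<bullet> y \<noteq> b" using 4 by auto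
    obtain e where e: "e > 0" "\<And>x. x \<in> affine hull S \<Longrightarrow> dist x z < e \<Longrightarrow> x \<in> S"
      using S z unfolding rel_open_convex_def openin_euclidean_subtopology_iff by metis
    have yz: "y \<noteq> z" using y z by auto
    \<comment> \<open>A displacement of length e/2: both points z + t(y - z) and z - t(y - z) stay
      in \<open>S\<close>, and they lie on opposite sides of the hyperplane.\<close>
    define t where "t = e / (2 * norm (y - z))"
    have t: "t > 0" "t * norm (y - z) < e" using e yz by (auto simp: t_def field_simps)
    have mem: "z + s *\<^sub>R (y - z) \<in> S" if "\<bar>s\<bar> = t" for s
    proof (rule e(2))
      have "z + s *\<^sub>R (y - z) = (1 - s) *\<^sub>R z + s *\<^sub>R y" by (simp add: algebra_simps)
      also have "\<dots> \<in> affine hull S"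
        using y z by (intro mem_affine) (auto simp: hull_inc)
      finally show "z + s *\<^sub>R (y - z) \<in> affine hull S" .
      show "dist (z + s *\<^sub>R (y - z)) z < e" using that t by (simp add: dist_norm)
    qed
    have p: "z + t *\<^sub>R (y - z) \<in> S" "z + (- t) *\<^sub>R (y - z) \<in> S"
      using mem[of t] mem[of "-t"] t by auto
    have ip: "a \<bullet> (z + s *\<^sub>R (y - z)) = b + s * (a \<bullet> y - b)" for s
      using z by (simp add: inner_add_right inner_diff_right)
    have ne: "?L \<noteq> {}" "?G \<noteq> {}"
      using p ip[of t] ip[of "-t"] y t mult_pos_pos[of t "a \<bullet> y - b"] mult_pos_neg[of t "a \<bullet> y - b"]
      by (cases "a \<bullet> y < b"; force simp del: scaleR_minus_left)+
    have "aff_dim ?L = aff_dim S" "aff_dim ?G = aff_dim S"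
      using rel_open_convex_Int_open(2)[OF S open_halfspace_lt convex_halfspace_lt] ne
        rel_open_convex_Int_open(2)[OF S open_halfspace_gt convex_halfspace_gt] by auto
    \<comment> \<open>Needed because \<open>nat\<close> truncates: only now does passing to
      \<open>aff_dim S - 1\<close> flip the sign.\<close>
    moreover have "aff_dim S \<ge> 1"
      using dimE 4(1) aff_dim_negative_iff[of ?E] by linarith
    then have "nat (aff_dim S) = Suc (nat (aff_dim S - 1))" by simp
    ultimately show ?thesis
      using ne 4 dimE z by auto
  qed
qed

text \<open>The three pieces are again relatively open and convex, so by induction the remaining
  hyperplanes leave their values unchanged, and the first cut is
  \<open>cell_euler_Nil_split\<close>.\<close>

lemma cell_euler_eq:
  "rel_open_convex S \<Longrightarrow> cell_euler hs S = cell_euler [] S"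
proof (induction hs arbitrary: S)
  case (Cons h hs)
  have "cell_euler (h # hs) S = cell_euler [] (S \<inter> {x. fst h \<bullet> x < snd h})
      + cell_euler [] (S \<inter> {x. fst h \<bullet> x = snd h}) + cell_euler [] (S \<inter> {x. fst h \<bullet> x > snd h})"
    unfolding cell_euler.simps(2)
    by (intro arg_cong2[where f="(+)"] Cons.IH rel_open_convex_Int_open rel_open_convex_Int_hyperplane
        Cons.prems open_halfspace_lt open_halfspace_gt convex_halfspace_lt convex_halfspace_gt)
  then show ?case
    using cell_euler_Nil_split[OF Cons.prems] by metis
qed simp

lemma resolves_trivial: "K \<inter> S = {} \<or> K \<subseteq> S \<Longrightarrow> resolves hs K S"
proof (induction hs arbitrary: K)
  case (Cons h hs)
  then have "(K \<inter> T) \<inter> S = {} \<or> K \<inter> T \<subseteq> S" for T by blast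
  then show ?case using Cons.IH by simp
qed simp

lemma resolves_Int:
  "resolves hs K S \<Longrightarrow> resolves hs K T \<Longrightarrow> resolves hs K (S \<inter> T)"
  by (induction hs arbitrary: K) (auto)

lemma resolves_mem:
  assumes "h \<in> set hs"
  shows "resolves hs K {x. fst h \<bullet> x < snd h}" "resolves hs K {x. fst h \<bullet> x = snd h}"
  using assms
proof (induction hs arbitrary: K)
  case (Cons g hs)
  { case 1 show ?case
      using Cons 1 by (cases "h = g") (auto intro!: resolves_trivial) }
  { case 2 show ?case
      using Cons 2 by (cases "h = g") (auto intro!: resolves_trivial) }
qed auto

text \<open>Each cell cut out by \<open>hs\<close> lies in one \<open>S i\<close> or misses them
  all. On such a cell the union agrees with a single member, and at most one summand is
  nonzero.\<close>

lemma cell_euler_disjoint_UN: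
  assumes "finite I" "disjoint_family_on S I" "\<And>i. i \<in> I \<Longrightarrow> resolves hs K (S i)"
  shows "cell_euler hs (K \<inter> (\<Union>i\<in>I. S i)) = (\<Sum>i\<in>I. cell_euler hs (K \<inter> S i))"
  using assms(3)
proof (induction hs arbitrary: K)
  case Nil
  show ?case
  proof (cases "\<exists>i\<in>I. K \<inter> S i \<noteq> {}")
    case True
    then obtain i where i: "i \<in> I" "K \<inter> S i \<noteq> {}" by blast
    have *: "K \<subseteq> S i" using Nil[OF i(1)] i by simp
    have "K \<inter> S j = {}" if "j \<in> I" "j \<noteq> i" for j
      using assms(2) that i * by (auto simp: disjoint_family_on_def)
    then have "(\<Sum>j\<in>I. cell_euler [] (K \<inter> S j)) = (\<Sum>j\<in>{i}. cell_euler [] (K \<inter> S j))"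
      using i assms(1) by (intro sum.mono_neutral_right) auto
    moreover have "K \<inter> (\<Union>i\<in>I. S i) = K" "K \<inter> S i = K" using * i by auto
    ultimately show ?thesis by simp
  next
    case False
    then have "K \<inter> (\<Union>i\<in>I. S i) = {}" by blast
    with False show ?thesis by simp
  qed
next
  case (Cons h hs)
  have *: "cell_euler hs (K \<inter> (\<Union>i\<in>I. S i) \<inter> T) = (\<Sum>i\<in>I. cell_euler hs (K \<inter> S i \<inter> T))"
    if "\<And>i. i \<in> I \<Longrightarrow> resolves hs (K \<inter> T) (S i)" for T
    using Cons.IH[of "K \<inter> T"] that by (simp add: Int_ac)
  show ?case
    using Cons.prems by (simp add: * sum.distrib)
qed

text \<open>These are the unions of cells of a finite hyperplane arrangement, closed or not, convex
  or not. Quantifying over all lists that contain \<open>H\<close> builds in stability under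
  refinement and reordering, so finitely many such sets are resolved together by concatenating their
  lists.\<close>

definition polyhedral :: "'a::euclidean_space set \<Rightarrow> bool" where
  "polyhedral S \<longleftrightarrow> (\<exists>H. \<forall>hs. set H \<subseteq> set hs \<longrightarrow> resolves hs UNIV S)"

lemma polyhedral_UNIV: "polyhedral UNIV"
  by (auto simp: polyhedral_def intro!: resolves_trivial)

lemma polyhedral_Int: "polyhedral S \<Longrightarrow> polyhedral T \<Longrightarrow> polyhedral (S \<inter> T)"
  unfolding polyhedral_def by (metis resolves_Int set_append le_sup_iff)

lemma polyhedral_INT: "finite I \<Longrightarrow> (\<And>i. i \<in> I \<Longrightarrow> polyhedral (S i)) \<Longrightarrow> polyhedral (\<Inter>i\<in>I. S i)"
  by (induction I rule: finite_induct) (auto simp: polyhedral_UNIV polyhedral_Int)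

lemma polyhedral_hyperplane: "polyhedral {x. a \<bullet> x = b}"
  and polyhedral_open_halfspace: "polyhedral {x. a \<bullet> x < b}"
  unfolding polyhedral_def using resolves_mem[of "(a, b)"]
  by (metis empty_set fst_conv insert_subset list.simps(15) snd_conv)+

lemma polyhedral_affine_hull: "polyhedral (affine hull S)"
proof -
  obtain F where F: "finite F" "affine hull S = \<Inter>F"
    "\<And>h. h \<in> F \<Longrightarrow> \<exists>a b. a \<noteq> 0 \<and> h = {x. a \<bullet> x = b}"
    using affine_hull_finite_intersection_hyperplanes[of S] by metis
  have "polyhedral (\<Inter>h\<in>F. h)"
  proof (rule polyhedral_INT[OF F(1)])
    fix h assume "h \<in> F"
    then obtain a b where "h = {x. a \<bullet> x = b}" using F(3) by blast
    then show "polyhedral h" using polyhedral_hyperplane by simp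
  qed
  then show ?thesis using F by simp
qed

lemma polyhedral_box: "polyhedral (box a b)"
proof -
  have "box a b = (\<Inter>i\<in>Basis. {x. (- i) \<bullet> x < - (a \<bullet> i)} \<inter> {x. i \<bullet> x < b \<bullet> i})"
    by (auto simp: box_def inner_commute)
  then show ?thesis
    by (simp only:) (intro polyhedral_INT polyhedral_Int polyhedral_open_halfspace finite_Basis)
qed

text \<open>In an irredundant description by half-spaces inside the affine hull, the relative
  interior arises by making every inequality strict; what remains is cut out by hyperplanes and open
  half-spaces.\<close>

lemma polyhedral_rel_interior:
  assumes "polyhedron S"
  shows "polyhedral (rel_interior S)"
proof -
  obtain F where F: "finite F" and seq: "S = affine hull S \<inter> \<Inter>F"
    and faceq: "\<And>h. h \<in> F \<Longrightarrow> \<exists>a b. a \<noteq> 0 \<and> h = {x. a \<bullet> x \<le> b}"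
    and psub: "\<And>F'. F' \<subset> F \<Longrightarrow> S \<subset> affine hull S \<inter> \<Inter>F'"
    using assms by (simp add: polyhedron_Int_affine_minimal) meson
  then obtain a b where ab: "\<And>h. h \<in> F \<Longrightarrow> a h \<noteq> 0 \<and> h = {x. a h \<bullet> x \<le> b h}"
    by metis
  have "rel_interior S = {x \<in> S. \<forall>h\<in>F. a h \<bullet> x < b h}"
    by (rule rel_interior_polyhedron_explicit[OF F seq ab psub])
  also have "\<dots> = affine hull S \<inter> (\<Inter>h\<in>F. {x. a h \<bullet> x < b h})"
  proof (intro set_eqI iffI)
    fix x assume "x \<in> {x \<in> S. \<forall>h\<in>F. a h \<bullet> x < b h}"
    then show "x \<in> affine hull S \<inter> (\<Inter>h\<in>F. {x. a h \<bullet> x < b h})" by (auto simp: hull_inc)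
  next
    fix x assume x: "x \<in> affine hull S \<inter> (\<Inter>h\<in>F. {x. a h \<bullet> x < b h})"
    have "x \<in> h" if "h \<in> F" for h
      using x that ab[OF that] by (auto intro: less_imp_le)
    then have "x \<in> S" using seq x by blast
    then show "x \<in> {x \<in> S. \<forall>h\<in>F. a h \<bullet> x < b h}" using x by auto
  qed
  finally show ?thesis
    using F by (simp only:) (intro polyhedral_Int polyhedral_INT polyhedral_affine_hull polyhedral_open_halfspace)
qed

text \<open>This replaces a common refinement. One list \<open>H @ G\<close> resolves all members of
  both partitions, and each sum equals \<open>cell_euler (H @ G)\<close> of the common union, a
  number that no longer knows the partition.\<close>

lemma sum_euler_eq_of_polyhedral_partitions:
  fixes S :: "'i \<Rightarrow> 'a::euclidean_space set" and T :: "'j \<Rightarrow> 'a set"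
  assumes I: "finite I" "disjoint_family_on S I" "\<And>i. i \<in> I \<Longrightarrow> polyhedral (S i) \<and> rel_open_convex (S i)"
    and J: "finite J" "disjoint_family_on T J" "\<And>j. j \<in> J \<Longrightarrow> polyhedral (T j) \<and> rel_open_convex (T j)"
    and eq: "(\<Union>i\<in>I. S i) = (\<Union>j\<in>J. T j)"
  shows "(\<Sum>i\<in>I. cell_euler [] (S i)) = (\<Sum>j\<in>J. cell_euler [] (T j))"
proof -
  have res: "\<exists>H. \<forall>i\<in>I. \<forall>hs. set H \<subseteq> set hs \<longrightarrow> resolves hs UNIV (S i)"
    if "finite I" "\<And>i. i \<in> I \<Longrightarrow> polyhedral (S i)" for I and S :: "'z \<Rightarrow> 'a set"
    using that
  proof (induction I rule: finite_induct)
    case (insert i I)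
    obtain H where H: "\<forall>i\<in>I. \<forall>hs. set H \<subseteq> set hs \<longrightarrow> resolves hs UNIV (S i)"
      using insert by blast
    obtain G where G: "\<forall>hs. set G \<subseteq> set hs \<longrightarrow> resolves hs UNIV (S i)"
      using insert.prems unfolding polyhedral_def by blast
    show ?case by (rule exI[of _ "H @ G"]) (use H G in auto)
  qed auto
  obtain H where H: "\<forall>i\<in>I. \<forall>hs. set H \<subseteq> set hs \<longrightarrow> resolves hs UNIV (S i)"
    using res[of I S] I by blast
  obtain G where G: "\<forall>j\<in>J. \<forall>hs. set G \<subseteq> set hs \<longrightarrow> resolves hs UNIV (T j)"
    using res[of J T] J by blast
  have "(\<Sum>i\<in>I. cell_euler [] (S i)) = (\<Sum>i\<in>I. cell_euler (H @ G) (S i))"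
    using I by (intro sum.cong) (simp_all only: cell_euler_eq[of _ "H @ G"])
  also have "\<dots> = cell_euler (H @ G) (\<Union>i\<in>I. S i)"
    using cell_euler_disjoint_UN[OF I(1,2), of "H @ G" UNIV] H by simp
  also have "\<dots> = (\<Sum>j\<in>J. cell_euler (H @ G) (T j))"
    unfolding eq using cell_euler_disjoint_UN[OF J(1,2), of "H @ G" UNIV] G by simp
  also have "\<dots> = (\<Sum>j\<in>J. cell_euler [] (T j))"
    using J by (intro sum.cong) (simp_all only: cell_euler_eq[of _ "H @ G"])
  finally show ?thesis .
qed

section \<open>Dissections into polytopes and their local alternating sums\<close>

definition dissection :: "'i set \<Rightarrow> ('i \<Rightarrow> 'a::euclidean_space set) \<Rightarrow> 'a set \<Rightarrow> bool" where
  "dissection I c X \<longleftrightarrow> finite I \<and> (\<forall>i\<in>I. polytope (c i) \<and> c i \<noteq> {}) \<and>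
     disjoint_family_on (\<lambda>i. rel_interior (c i)) I \<and> (\<Union>i\<in>I. rel_interior (c i)) = X"

text \<open>In a dissection only the relative interiors partition \<open>X\<close>; the closed cells
  may leave \<open>X\<close> and need not meet face to face. This admits open stars. The sum over
  closed cells through \<open>x\<close> is the Euler characteristic with compact supports of
  \<open>X\<close> inside a small open box around \<open>x\<close>.\<close>

definition local_euler :: "'i set \<Rightarrow> ('i \<Rightarrow> 'a::euclidean_space set) \<Rightarrow> 'a \<Rightarrow> int" where
  "local_euler I c x = (\<Sum>i\<in>{i\<in>I. x \<in> c i}. (-1) ^ nat (aff_dim (c i)))"

text \<open>The cells that miss \<open>x\<close> form a closed set, so a small box avoids them. A
  cell through \<open>x\<close> has \<open>x\<close> in the closure of its relative interior, so the
  box cuts out of that interior a nonempty relatively open convex set of the same dimension.\<close>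

lemma local_euler_box:
  assumes "dissection I c X"
  obtains e where "e > 0" "\<And>a b. x \<in> box a b \<Longrightarrow> box a b \<subseteq> ball x e \<Longrightarrow>
    local_euler I c x = (\<Sum>i\<in>I. cell_euler [] (rel_interior (c i) \<inter> box a b))"
proof -
  have fin: "finite I" and poly: "\<And>i. i \<in> I \<Longrightarrow> polytope (c i)"
    using assms by (auto simp: dissection_def)
  have "closed (\<Union>i\<in>{i\<in>I. x \<notin> c i}. c i)"
    using fin poly by (intro closed_UN) (auto simp: polytope_imp_closed)
  then have "open (- (\<Union>i\<in>{i\<in>I. x \<notin> c i}. c i))" "x \<in> - (\<Union>i\<in>{i\<in>I. x \<notin> c i}. c i)"
    unfolding closed_def by auto
  then obtain e where e: "e > 0" "ball x e \<subseteq> - (\<Union>i\<in>{i\<in>I. x \<notin> c i}. c i)"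
    by (meson open_contains_ball)
  have "local_euler I c x = (\<Sum>i\<in>I. cell_euler [] (rel_interior (c i) \<inter> box a b))"
    if ab: "x \<in> box a b" "box a b \<subseteq> ball x e" for a b
  proof -
    have 1: "cell_euler [] (rel_interior (c i) \<inter> box a b) = 0" if "i \<in> I" "x \<notin> c i" for i
    proof -
      have "rel_interior (c i) \<inter> box a b = {}"
        using e(2) that ab(2) rel_interior_subset[of "c i"] by blast
      then show ?thesis by simp
    qed
    have 2: "cell_euler [] (rel_interior (c i) \<inter> box a b) = (-1) ^ nat (aff_dim (c i))"
      if i: "i \<in> I" "x \<in> c i" for i
    proof -
      have cv: "convex (c i)" using poly i polytope_imp_convex by blast
      have "x \<in> closure (rel_interior (c i))"
        using convex_closure_rel_interior[OF cv] i closure_subset by blast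
      then have ne: "rel_interior (c i) \<inter> box a b \<noteq> {}"
        using ab(1) open_box[of a b] unfolding closure_iff_nhds_not_empty by blast
      have "rel_open_convex (rel_interior (c i))"
        using cv convex_rel_interior openin_rel_interior rel_interior_same_affine_hull
        by (metis rel_open_convex_def)
      from rel_open_convex_Int_open(2)[OF this open_box convex_box(2) ne]
      show ?thesis using ne rel_interior_aff_dim[OF cv] by simp
    qed
    have "(\<Sum>i\<in>I. cell_euler [] (rel_interior (c i) \<inter> box a b))
        = (\<Sum>i\<in>{i\<in>I. x \<in> c i}. cell_euler [] (rel_interior (c i) \<inter> box a b))"
      using fin 1 by (intro sum.mono_neutral_right) auto
    also have "\<dots> = local_euler I c x"
      unfolding local_euler_def using 2 by (intro sum.cong) auto
    finally show ?thesis by simp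
  qed
  with e(1) show ?thesis using that by blast
qed

text \<open>Inside one box small enough for both dissections, the cut relative interiors form two
  polyhedral partitions of the same set \<open>X \<inter> box a b\<close>.\<close>

lemma local_euler_unique:
  fixes x :: "'a::euclidean_space"
  assumes I: "dissection I c X" and J: "dissection J d X"
  shows "local_euler I c x = local_euler J d x"
proof -
  obtain e where e: "e > 0" "\<And>a b. x \<in> box a b \<Longrightarrow> box a b \<subseteq> ball x e \<Longrightarrow>
    local_euler I c x = (\<Sum>i\<in>I. cell_euler [] (rel_interior (c i) \<inter> box a b))"
    using local_euler_box[OF I] by blast
  obtain e' where e': "e' > 0" "\<And>a b. x \<in> box a b \<Longrightarrow> box a b \<subseteq> ball x e' \<Longrightarrow>
    local_euler J d x = (\<Sum>i\<in>J. cell_euler [] (rel_interior (d i) \<inter> box a b))"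
    using local_euler_box[OF J] by blast
  obtain a b where ab: "x \<in> box a b" "box a b \<subseteq> ball x (min e e')"
    using rational_boxes[of "min e e'" x] e(1) e'(1) by auto
  have cell: "polyhedral (rel_interior P \<inter> box a b) \<and> rel_open_convex (rel_interior P \<inter> box a b)"
    if "polytope P" for P
  proof
    show "polyhedral (rel_interior P \<inter> box a b)"
      using that by (intro polyhedral_Int polyhedral_box polyhedral_rel_interior polytope_imp_polyhedron)
    have "rel_open_convex (rel_interior P)"
      using that convex_rel_interior openin_rel_interior rel_interior_same_affine_hull polytope_imp_convex
      by (metis rel_open_convex_def)
    then show "rel_open_convex (rel_interior P \<inter> box a b)"
      using rel_open_convex_Int_open(1)[OF _ open_box convex_box(2)] by blast
  qed
  have disj: "disjoint_family_on (\<lambda>i. rel_interior (c i) \<inter> box a b) I"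
    if "dissection I c X" for I and c :: "'z \<Rightarrow> 'a set"
    using that unfolding dissection_def disjoint_family_on_def by blast
  have un: "(\<Union>i\<in>I. rel_interior (c i) \<inter> box a b) = X \<inter> box a b"
    if "dissection I c X" for I and c :: "'z \<Rightarrow> 'a set"
    using that unfolding dissection_def by blast
  have "(\<Sum>i\<in>I. cell_euler [] (rel_interior (c i) \<inter> box a b))
      = (\<Sum>i\<in>J. cell_euler [] (rel_interior (d i) \<inter> box a b))"
  proof (rule sum_euler_eq_of_polyhedral_partitions)
    show "(\<Union>i\<in>I. rel_interior (c i) \<inter> box a b) = (\<Union>i\<in>J. rel_interior (d i) \<inter> box a b)"
      using un[OF I] un[OF J] by simp
  qed (use cell disj[OF I] disj[OF J] I J in \<open>simp_all add: dissection_def\<close>)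
  then show ?thesis
    using e(2) e'(2) ab by (metis ball_min_Int le_inf_iff)
qed

text \<open>The global counterpart, needed at the apex of a cone, where every cell over the base
  contributes.\<close>

lemma dissection_euler_unique:
  fixes X :: "'a::euclidean_space set"
  assumes I: "dissection I c X" and J: "dissection J d X"
  shows "(\<Sum>i\<in>I. (-1) ^ nat (aff_dim (c i)) :: int) = (\<Sum>j\<in>J. (-1) ^ nat (aff_dim (d j)))"
proof -
  have cell: "polyhedral (rel_interior P) \<and> rel_open_convex (rel_interior P)"
    if "polytope P" for P :: "'a set"
    using that convex_rel_interior openin_rel_interior rel_interior_same_affine_hull polytope_imp_convex
      polyhedral_rel_interior polytope_imp_polyhedron
    by (metis rel_open_convex_def)
  have value_cell: "cell_euler [] (rel_interior P) = (-1) ^ nat (aff_dim P)" if "polytope P" "P \<noteq> {}" for P :: "'a set"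
    using that polytope_imp_convex[of P] by (simp add: rel_interior_eq_empty rel_interior_aff_dim)
  have "(\<Sum>i\<in>I. cell_euler [] (rel_interior (c i))) = (\<Sum>j\<in>J. cell_euler [] (rel_interior (d j)))"
    using I J cell by (intro sum_euler_eq_of_polyhedral_partitions) (simp_all add: dissection_def)
  moreover have "(\<Sum>i\<in>I. cell_euler [] (rel_interior (c i))) = (\<Sum>i\<in>I. (-1) ^ nat (aff_dim (c i)))"
    using I value_cell by (intro sum.cong) (auto simp: dissection_def simp del: cell_euler.simps)
  moreover have "(\<Sum>j\<in>J. cell_euler [] (rel_interior (d j))) = (\<Sum>j\<in>J. (-1) ^ nat (aff_dim (d j)))"
    using J value_cell by (intro sum.cong) (auto simp: dissection_def simp del: cell_euler.simps)
  ultimately show ?thesis by simp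
qed

section \<open>Cones\<close>

text \<open>Every ray from \<open>v\<close> meets \<open>L\<close> at most once, so \<open>L\<close> is the base of a cone with apex \<open>v\<close>.\<close>

definition cone_position :: "'a::euclidean_space \<Rightarrow> 'a set \<Rightarrow> bool" where
  "cone_position v L \<longleftrightarrow> v \<notin> L \<and> (\<forall>y\<in>L. \<forall>z\<in>L. \<forall>c>0. z - v = c *\<^sub>R (y - v) \<longrightarrow> z = y)"

text \<open>The base is left out so that the cone over a link is the open star. Inserting the apex
  separately makes the cone over the empty set a point, the star of an isolated vertex.\<close>

definition open_cone :: "'a::euclidean_space \<Rightarrow> 'a set \<Rightarrow> 'a set" where
  "open_cone v L = insert v {v + t *\<^sub>R (y - v) |t y. 0 < t \<and> t < 1 \<and> y \<in> L}"

lemma cone_position_unique: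
  assumes "cone_position v L" "y \<in> L" "z \<in> L" "s > 0" "t > 0"
    and eq: "v + s *\<^sub>R (y - v) = v + t *\<^sub>R (z - v)"
  shows "z = y" "s = t"
proof -
  have "t *\<^sub>R (z - v) = s *\<^sub>R (y - v)" using eq by simp
  then have "(1 / t) *\<^sub>R (t *\<^sub>R (z - v)) = (1 / t) *\<^sub>R (s *\<^sub>R (y - v))" by simp
  then have "z - v = (s / t) *\<^sub>R (y - v)" using \<open>t > 0\<close> by simp
  then show "z = y"
    using assms divide_pos_pos[of s t] unfolding cone_position_def by metis
  moreover have "y \<noteq> v" using assms by (auto simp: cone_position_def)
  ultimately show "s = t" using eq by simp
qed

lemma convex_hull_insert_cone:
  assumes "convex S" "S \<noteq> {}"
  shows "convex hull (insert v S) = {v + t *\<^sub>R (y - v) |t y. 0 \<le> t \<and> t \<le> 1 \<and> y \<in> S}"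
  using assms by (auto simp: convex_hull_insert_alt hull_same algebra_simps)

lemma rel_interior_convex_hull_insert_cone:
  fixes S :: "'a::euclidean_space set"
  assumes "convex S" "S \<noteq> {}"
  shows "rel_interior (convex hull (insert v S))
    = {v + t *\<^sub>R (y - v) |t y. 0 < t \<and> t < 1 \<and> y \<in> rel_interior S}"
proof -
  let ?U = "\<lambda>b. if b then S else {v}"
  have "rel_interior (convex hull (\<Union>(?U ` UNIV))) =
      {sum (\<lambda>b. c b *\<^sub>R s b) UNIV |c s. (\<forall>b\<in>UNIV. c b > 0) \<and> sum c UNIV = 1 \<and>
        (\<forall>b\<in>UNIV. s b \<in> rel_interior (?U b))}"
    using assms by (intro rel_interior_convex_hull_union) auto
  also have "\<Union>(?U ` UNIV) = insert v S" by (auto split: if_splits)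
  finally have *: "rel_interior (convex hull (insert v S)) =
      {c False *\<^sub>R s False + c True *\<^sub>R s True |c s. 0 < c False \<and> 0 < c True \<and> c False + c True = 1 \<and>
        s False = v \<and> s True \<in> rel_interior S}"
    by (simp add: UNIV_bool conj_ac)
  show ?thesis
    unfolding *
  proof (intro set_eqI iffI; clarify)
    fix c :: "bool \<Rightarrow> real" and s :: "bool \<Rightarrow> 'a"
    assume c: "0 < c False" "0 < c True" "c False + c True = 1" "s True \<in> rel_interior S"
    have f: "c False = 1 - c True" using c by simp
    show "\<exists>t y. c False *\<^sub>R s False + c True *\<^sub>R s True = s False + t *\<^sub>R (y - s False) \<and> 0 < t \<and> t < 1 \<and> y \<in> rel_interior S"
      using c by (intro exI[of _ "c True"] exI[of _ "s True"]) (auto simp: f algebra_simps)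
  next
    fix t y assume t: "0 < t" "t < (1::real)" "y \<in> rel_interior S"
    show "\<exists>c s. v + t *\<^sub>R (y - v) = c False *\<^sub>R s False + c True *\<^sub>R s True \<and>
       0 < c False \<and> 0 < c True \<and> c False + c True = 1 \<and> s False = v \<and> s True \<in> rel_interior S"
      using t by (intro exI[of _ "\<lambda>b. if b then t else 1 - t"] exI[of _ "\<lambda>b. if b then y else v"])
        (auto simp: algebra_simps)
  qed
qed

text \<open>Otherwise the ray from \<open>v\<close> through a relative interior point
  \<open>y\<close> of \<open>S\<close> would continue inside \<open>S\<close> a little beyond
  \<open>y\<close>, giving a second point of \<open>L\<close> on that ray.\<close>

lemma cone_position_not_in_affine_hull:
  assumes cp: "cone_position v L" and S: "convex S" "S \<subseteq> L"
  shows "v \<notin> affine hull S"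
proof
  assume v: "v \<in> affine hull S"
  then have "rel_interior S \<noteq> {}" using S rel_interior_eq_empty by force
  then obtain y where y: "y \<in> rel_interior S" by blast
  obtain e where e: "e > 0" "ball y e \<inter> affine hull S \<subseteq> S" and yS: "y \<in> S"
    using y unfolding mem_rel_interior_ball by blast
  have yv: "y \<noteq> v" using cp yS S by (auto simp: cone_position_def)
  define t where "t = e / (2 * norm (y - v))"
  have t: "t > 0" "t * norm (y - v) < e" using e yv by (auto simp: t_def field_simps)
  define z where "z = y + t *\<^sub>R (y - v)"
  have "z = (1 + t) *\<^sub>R y + (- t) *\<^sub>R v" by (simp add: z_def algebra_simps)
  also have "\<dots> \<in> affine hull S"
    using v yS by (intro mem_affine) (auto simp: hull_inc)
  finally have "z \<in> affine hull S" .
  moreover have "dist y z < e" using t by (simp add: z_def dist_norm)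
  ultimately have "z \<in> S" using e(2) by auto
  moreover have "z - v = (1 + t) *\<^sub>R (y - v)" by (simp add: z_def algebra_simps)
  ultimately have "z = y"
    using cp yS S(2) t add_pos_pos[of 1 t] zero_less_one unfolding cone_position_def by blast
  then show False using t yv by (simp add: z_def)
qed

lemma aff_dim_convex_hull_insert:
  assumes "cone_position v L" "convex S" "S \<subseteq> L"
  shows "aff_dim (convex hull (insert v S)) = aff_dim S + 1"
  using cone_position_not_in_affine_hull[OF assms] by (simp add: aff_dim_convex_hull aff_dim_insert)

lemma in_convex_hull_insert_cone_iff:
  assumes cp: "cone_position v L" and S: "convex S" "S \<noteq> {}" "S \<subseteq> L"
    and z: "z \<in> L" and s: "0 < s" "s \<le> 1"
  shows "v + s *\<^sub>R (z - v) \<in> convex hull (insert v S) \<longleftrightarrow> z \<in> S"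
proof
  assume "v + s *\<^sub>R (z - v) \<in> convex hull (insert v S)"
  then obtain t y where ty: "v + s *\<^sub>R (z - v) = v + t *\<^sub>R (y - v)" "0 \<le> t" "y \<in> S"
    using convex_hull_insert_cone[OF S(1,2)] by auto
  have "z \<noteq> v" using cp z by (auto simp: cone_position_def)
  then have "t \<noteq> 0" using ty(1) s by auto
  then show "z \<in> S"
    using cone_position_unique(1)[OF cp z _ s(1) _ ty(1)] ty S by auto
qed (use s S in \<open>auto simp: convex_hull_insert_cone\<close>)

text \<open>The apex is a cell of its own (\<open>None\<close>), because the relative interiors of
  the cones over base cells miss it when the base is in cone position.\<close>

fun cone_cell :: "'a::euclidean_space \<Rightarrow> ('i \<Rightarrow> 'a set) \<Rightarrow> 'i option \<Rightarrow> 'a set" where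
  "cone_cell v c None = {v}"
| "cone_cell v c (Some i) = convex hull (insert v (c i))"

lemma dissection_cone:
  assumes dis: "dissection I c L" and cp: "cone_position v L"
  shows "dissection (insert None (Some ` I)) (cone_cell v c) (open_cone v L)"
  unfolding dissection_def
proof (intro conjI)
  have fin: "finite I" and poly: "\<And>i. i \<in> I \<Longrightarrow> polytope (c i)" and ne: "\<And>i. i \<in> I \<Longrightarrow> c i \<noteq> {}"
    and disj: "\<And>i j. i \<in> I \<Longrightarrow> j \<in> I \<Longrightarrow> i \<noteq> j \<Longrightarrow> rel_interior (c i) \<inter> rel_interior (c j) = {}"
    and un: "(\<Union>i\<in>I. rel_interior (c i)) = L"
    using dis by (auto simp: dissection_def disjoint_family_on_def)
  have cv: "convex (c i)" if "i \<in> I" for i using poly that polytope_imp_convex by blast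
  have ri: "rel_interior (convex hull (insert v (c i)))
      = {v + t *\<^sub>R (y - v) |t y. 0 < t \<and> t < 1 \<and> y \<in> rel_interior (c i)}" if "i \<in> I" for i
    using that cv ne by (intro rel_interior_convex_hull_insert_cone) auto
  have riL: "rel_interior (c i) \<subseteq> L" if "i \<in> I" for i using un that by blast
  show "finite (insert None (Some ` I))" using fin by simp
  show "\<forall>i\<in>insert None (Some ` I). polytope (cone_cell v c i) \<and> cone_cell v c i \<noteq> {}"
  proof (intro ballI)
    fix i assume "i \<in> insert None (Some ` I)"
    then show "polytope (cone_cell v c i) \<and> cone_cell v c i \<noteq> {}"
    proof
      assume "i \<in> Some ` I"
      then obtain j where j: "i = Some j" "j \<in> I" by auto
      obtain F where "finite F" "c j = convex hull F"
        using poly[OF j(2)] unfolding polytope_def by blast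
      then have "convex hull (insert v (c j)) = convex hull (insert v F)"
        by (metis hull_insert)
      then have "polytope (convex hull (insert v (c j)))"
        using \<open>finite F\<close> unfolding polytope_def by auto
      then show ?thesis using j by simp
    qed (simp add: polytope_sing)
  qed
  have vn: "v \<notin> rel_interior (convex hull (insert v (c i)))" if i: "i \<in> I" for i
  proof
    assume "v \<in> rel_interior (convex hull (insert v (c i)))"
    then obtain t y where "v = v + t *\<^sub>R (y - v)" "t > 0" "y \<in> rel_interior (c i)"
      using ri[OF i] by auto
    then have "v \<in> L" using riL[OF i] by auto
    then show False using cp by (simp add: cone_position_def)
  qed
  have dd: "rel_interior (convex hull (insert v (c i))) \<inter> rel_interior (convex hull (insert v (c j))) = {}"
    if ij: "i \<in> I" "j \<in> I" "i \<noteq> j" for i j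
  proof (rule ccontr)
    assume "\<not> ?thesis"
    then obtain s y t z where "v + s *\<^sub>R (y - v) = v + t *\<^sub>R (z - v)" "s > 0" "t > 0"
      "y \<in> rel_interior (c i)" "z \<in> rel_interior (c j)"
      unfolding ri[OF ij(1)] ri[OF ij(2)] by blast
    then have "z = y" using cone_position_unique(1)[OF cp] riL ij by blast
    then show False using disj[OF ij] \<open>y \<in> _\<close> \<open>z \<in> _\<close> by blast
  qed
  show "disjoint_family_on (\<lambda>i. rel_interior (cone_cell v c i)) (insert None (Some ` I))"
    unfolding disjoint_family_on_def using vn dd by auto
  have "(\<Union>i\<in>insert None (Some ` I). rel_interior (cone_cell v c i))
      = insert v (\<Union>i\<in>I. {v + t *\<^sub>R (y - v) |t y. 0 < t \<and> t < 1 \<and> y \<in> rel_interior (c i)})"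
    using ri by simp
  also have "\<dots> = open_cone v L"
    unfolding open_cone_def un[symmetric] by blast
  finally show "(\<Union>i\<in>insert None (Some ` I). rel_interior (cone_cell v c i)) = open_cone v L" .
qed

text \<open>All cells contain the apex; the apex cell counts 1 and each other cell has the opposite
  sign of its base cell. A point on the ray through \<open>z\<close>, other than the apex, lies
  exactly in the cones over the base cells through \<open>z\<close>. That these closed cells stay in
  \<open>L\<close> is what gives them cone position.\<close>

lemma local_euler_cone:
  assumes dis: "dissection I c L" and cp: "cone_position v L"
    and sub: "\<And>i. i \<in> I \<Longrightarrow> c i \<subseteq> L"
  shows "local_euler (insert None (Some ` I)) (cone_cell v c) v = 1 - (\<Sum>i\<in>I. (-1) ^ nat (aff_dim (c i)))"
    and "z \<in> L \<Longrightarrow> 0 < s \<Longrightarrow> s \<le> 1 \<Longrightarrow>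
      local_euler (insert None (Some ` I)) (cone_cell v c) (v + s *\<^sub>R (z - v)) = - local_euler I c z"
proof -
  have fin: "finite I" and cne: "\<And>i. i \<in> I \<Longrightarrow> convex (c i) \<and> c i \<noteq> {}"
    using dis polytope_imp_convex by (auto simp: dissection_def)
  have dim: "(-1 :: int) ^ nat (aff_dim (convex hull (insert v (c i)))) = - ((-1) ^ nat (aff_dim (c i)))"
    if "i \<in> I" for i
  proof -
    have "aff_dim (c i) \<ge> 0" using cne[OF that] aff_dim_negative_iff[of "c i"] by linarith
    then show ?thesis
      using aff_dim_convex_hull_insert[OF cp _ sub[OF that]] cne[OF that] by (simp add: nat_add_distrib)
  qed
  have "local_euler (insert None (Some ` I)) (cone_cell v c) v
      = (\<Sum>i\<in>insert None (Some ` I). (-1) ^ nat (aff_dim (cone_cell v c i)))"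
    unfolding local_euler_def by (intro sum.cong) (auto simp: hull_inc)
  also have "\<dots> = 1 + (\<Sum>i\<in>I. (-1) ^ nat (aff_dim (convex hull (insert v (c i)))))"
    using fin by (subst sum.insert) (auto simp: sum.reindex)
  also have "\<dots> = 1 - (\<Sum>i\<in>I. (-1) ^ nat (aff_dim (c i)))"
    using dim by (simp add: sum_negf)
  finally show "local_euler (insert None (Some ` I)) (cone_cell v c) v = 1 - (\<Sum>i\<in>I. (-1) ^ nat (aff_dim (c i)))" .
  assume z: "z \<in> L" and s: "0 < s" "s \<le> 1"
  have "z \<noteq> v" using cp z by (auto simp: cone_position_def)
  then have "{i \<in> insert None (Some ` I). v + s *\<^sub>R (z - v) \<in> cone_cell v c i} = Some ` {i\<in>I. z \<in> c i}"
    using s in_convex_hull_insert_cone_iff[OF cp _ _ sub z s] cne by auto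
  then have "local_euler (insert None (Some ` I)) (cone_cell v c) (v + s *\<^sub>R (z - v))
      = (\<Sum>i\<in>{i\<in>I. z \<in> c i}. (-1) ^ nat (aff_dim (convex hull (insert v (c i)))))"
    unfolding local_euler_def by (simp add: sum.reindex)
  also have "\<dots> = - local_euler I c z"
    unfolding local_euler_def using dim by (simp add: sum_negf)
  finally show "local_euler (insert None (Some ` I)) (cone_cell v c) (v + s *\<^sub>R (z - v)) = - local_euler I c z" .
qed

text \<open>Continuity, notably at the apex, comes from a quotient: by compactness the
  parametrization \<open>q\<close> of the closed cone by \<open>{0..1} \<times> L\<close> is a
  quotient map, and the desired map is constant on its fibres. An empty \<open>L\<close> is separate
  since the parametrization then misses the apex.\<close>

lemma cone_extension:
  fixes f :: "'a::euclidean_space \<Rightarrow> 'b::euclidean_space"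
  assumes cp: "cone_position v L" and L: "compact L" and f: "continuous_on L f"
  obtains F where "continuous_on (open_cone v L) F" "F v = p"
    "\<And>y t. y \<in> L \<Longrightarrow> 0 < t \<Longrightarrow> t < 1 \<Longrightarrow> F (v + t *\<^sub>R (y - v)) = p + t *\<^sub>R (f y - p)"
proof (cases "L = {}")
  case True
  then show ?thesis by (intro that[of "\<lambda>_. p"]) (auto simp: open_cone_def)
next
  case False
  define K where "K = {0..1::real} \<times> L"
  define q where "q = (\<lambda>(t, y). v + t *\<^sub>R (y - v))"
  define \<Phi> where "\<Phi> = (\<lambda>(t, y). p + t *\<^sub>R (f y - p))"
  \<comment> \<open>The only fibre of \<open>q\<close> with several points can be
    \<open>{0} \<times> L\<close>, over the apex, where \<open>\<Phi>\<close> is constantly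
    \<open>p\<close>.\<close>
  have compat: "\<Phi> k = \<Phi> l" if "k \<in> K" "l \<in> K" "q k = q l" for k l
  proof -
    obtain s y t z where kl: "k = (s, y)" "l = (t, z)" by fastforce
    have mem: "y \<in> L" "z \<in> L" "0 \<le> s" "0 \<le> t" using that kl by (auto simp: K_def)
    have eq: "v + s *\<^sub>R (y - v) = v + t *\<^sub>R (z - v)" using that kl by (simp add: q_def)
    have "y \<noteq> v" "z \<noteq> v" using mem cp by (auto simp: cone_position_def)
    then have "s = 0 \<longleftrightarrow> t = 0" using eq by auto
    then show ?thesis
      using cone_position_unique[OF cp mem(1,2) _ _ eq] mem kl by (cases "s = 0") (auto simp: \<Phi>_def)
  qed
  define F where "F x = \<Phi> (SOME k. k \<in> K \<and> q k = x)" for x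
  have Fq: "F (q k) = \<Phi> k" if "k \<in> K" for k
  proof -
    have "\<exists>l. l \<in> K \<and> q l = q k" using that by blast
    from someI_ex[OF this] show ?thesis unfolding F_def using compat that by blast
  qed
  have contq: "continuous_on K q"
    unfolding q_def split_beta by (intro continuous_intros)
  have cont\<Phi>: "continuous_on K \<Phi>"
    unfolding \<Phi>_def split_beta K_def
    by (intro continuous_intros continuous_on_compose2[OF f]) auto
  have comK: "compact K" unfolding K_def using L by (intro compact_Times) auto
  have "continuous_on (q ` K) F"
    unfolding continuous_openin_preimage_eq
  proof (intro allI impI)
    fix U :: "'b set" assume "open U"
    have "K \<inter> q -` (q ` K \<inter> F -` U) = K \<inter> \<Phi> -` U"
    proof (intro set_eqI iffI)
      fix k assume k: "k \<in> K \<inter> q -` (q ` K \<inter> F -` U)"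
      then have "F (q k) \<in> U" by simp
      then show "k \<in> K \<inter> \<Phi> -` U" using Fq k by simp
    next
      fix k assume "k \<in> K \<inter> \<Phi> -` U"
      then show "k \<in> K \<inter> q -` (q ` K \<inter> F -` U)" using Fq by simp
    qed
    moreover have "openin (top_of_set K) (K \<inter> \<Phi> -` U)"
      using cont\<Phi> \<open>open U\<close> continuous_openin_preimage_eq by blast
    ultimately show "openin (top_of_set (q ` K)) (q ` K \<inter> F -` U)"
      using Abstract_Topology_2.continuous_imp_quotient_map[OF contq refl comK, of "q ` K \<inter> F -` U"] by simp
  qed
  moreover have "open_cone v L \<subseteq> q ` K"
  proof
    fix x assume "x \<in> open_cone v L"
    then consider "x = v" | t y where "x = v + t *\<^sub>R (y - v)" "0 < t" "t < 1" "y \<in> L"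
      by (auto simp: open_cone_def)
    then show "x \<in> q ` K"
    proof cases
      case 1
      obtain y where "y \<in> L" using False by blast
      then show ?thesis using 1 by (intro image_eqI[of _ _ "(0, y)"]) (auto simp: q_def K_def)
    next
      case 2
      then show ?thesis by (intro image_eqI[of _ _ "(t, y)"]) (auto simp: q_def K_def)
    qed
  qed
  ultimately have "continuous_on (open_cone v L) F"
    using continuous_on_subset by blast
  moreover have "F v = p"
  proof -
    obtain y where "y \<in> L" using False by blast
    then show ?thesis using Fq[of "(0, y)"] by (simp add: K_def q_def \<Phi>_def)
  qed
  moreover have "F (v + t *\<^sub>R (y - v)) = p + t *\<^sub>R (f y - p)" if "y \<in> L" "0 < t" "t < 1" for y t
    using Fq[of "(t, y)"] that by (simp add: K_def q_def \<Phi>_def)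
  ultimately show ?thesis using that by blast
qed

lemma cone_homeomorphism:
  fixes f :: "'a::euclidean_space \<Rightarrow> 'b::euclidean_space"
  assumes cp: "cone_position v L" "cone_position p Q" and L: "compact L"
    and fg: "homeomorphism L Q f g"
  obtains F G where "homeomorphism (open_cone v L) (open_cone p Q) F G" "F v = p"
    "\<And>y t. y \<in> L \<Longrightarrow> 0 < t \<Longrightarrow> t < 1 \<Longrightarrow> F (v + t *\<^sub>R (y - v)) = p + t *\<^sub>R (f y - p)"
proof -
  have f: "continuous_on L f" and g: "continuous_on Q g" and Q: "f ` L = Q" "g ` Q = L"
    and inv: "\<And>x. x \<in> L \<Longrightarrow> g (f x) = x" "\<And>y. y \<in> Q \<Longrightarrow> f (g y) = y"
    using fg by (auto simp: homeomorphism_def)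
  have "compact Q" using compact_continuous_image[OF f L] Q by simp
  obtain F where F: "continuous_on (open_cone v L) F" "F v = p"
    "\<And>y t. y \<in> L \<Longrightarrow> 0 < t \<Longrightarrow> t < 1 \<Longrightarrow> F (v + t *\<^sub>R (y - v)) = p + t *\<^sub>R (f y - p)"
    using cone_extension[OF cp(1) L f] by blast
  obtain G where G: "continuous_on (open_cone p Q) G" "G p = v"
    "\<And>y t. y \<in> Q \<Longrightarrow> 0 < t \<Longrightarrow> t < 1 \<Longrightarrow> G (p + t *\<^sub>R (y - p)) = v + t *\<^sub>R (g y - v)"
    using cone_extension[OF cp(2) \<open>compact Q\<close> g] by blast
  have "homeomorphism (open_cone v L) (open_cone p Q) F G"
  proof (rule homeomorphismI[OF F(1) G(1)])
    show "F ` open_cone v L \<subseteq> open_cone p Q"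
      using F(2,3) Q by (fastforce simp: open_cone_def)
    show "G ` open_cone p Q \<subseteq> open_cone v L"
      using G(2,3) Q by (fastforce simp: open_cone_def)
    show "G (F x) = x" if "x \<in> open_cone v L" for x
      using that F(2,3) G(2,3) Q inv by (auto simp: open_cone_def)
    show "F (G y) = y" if "y \<in> open_cone p Q" for y
      using that F(2,3) G(2,3) Q inv by (auto simp: open_cone_def)
  qed
  then show ?thesis using that F by blast
qed

text \<open>A ray from a relative interior point of a compact convex set stays in the relative
  interior until it reaches the frontier, and it never meets the frontier again.\<close>

lemma cone_rel_frontier:
  fixes S :: "'a::euclidean_space set"
  assumes S: "convex S" "compact S" and p: "p \<in> rel_interior S"
  shows "cone_position p (rel_frontier S)" "open_cone p (rel_frontier S) = rel_interior S"
proof -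
  have fr: "rel_frontier S = S - rel_interior S"
    using S by (simp add: rel_frontier_def compact_imp_closed)
  have shrink: "p + c *\<^sub>R (y - p) \<in> rel_interior S" if "y \<in> S" "0 < c" "c < 1" for y c
    using rel_interior_convex_shrink[OF S(1) p that(1), of "1 - c"] that by (simp add: algebra_simps)
  show "cone_position p (rel_frontier S)"
    unfolding cone_position_def
  proof (intro conjI ballI allI impI)
    show "p \<notin> rel_frontier S" using p fr by blast
    fix y z c assume y: "y \<in> rel_frontier S" and z: "z \<in> rel_frontier S" and c: "0 < c"
      and eq: "z - p = c *\<^sub>R (y - p)"
    have "\<not> c < 1"
    proof
      assume "c < 1"
      moreover have "z = p + c *\<^sub>R (y - p)" using eq by (simp add: algebra_simps)
      ultimately show False using shrink y z c fr by blast
    qed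
    moreover have "\<not> c > 1"
    proof
      assume "c > 1"
      have "(1 / c) *\<^sub>R (z - p) = y - p" using eq c by simp
      then have "y = p + (1 / c) *\<^sub>R (z - p)" by simp
      moreover have "0 < 1 / c" "1 / c < 1" using \<open>c > 1\<close> by auto
      ultimately show False using shrink y z fr by blast
    qed
    ultimately have "c = 1" by simp
    then show "z = y" using eq by simp
  qed
  show "open_cone p (rel_frontier S) = rel_interior S"
  proof
    show "open_cone p (rel_frontier S) \<subseteq> rel_interior S"
      using shrink p fr by (auto simp: open_cone_def)
    show "rel_interior S \<subseteq> open_cone p (rel_frontier S)"
    proof
      fix x assume x: "x \<in> rel_interior S"
      show "x \<in> open_cone p (rel_frontier S)"
      proof (cases "x = p")
        case False
        have "p + (x - p) \<in> affine hull S"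
          using x rel_interior_subset hull_subset[of S affine] by auto
        then obtain t where t: "0 < t" "p + t *\<^sub>R (x - p) \<in> rel_frontier S"
          "\<And>e. 0 \<le> e \<Longrightarrow> e < t \<Longrightarrow> p + e *\<^sub>R (x - p) \<in> rel_interior S"
          using ray_to_rel_frontier[OF compact_imp_bounded[OF S(2)] p, of "x - p"] False by auto
        \<comment> \<open>The frontier lies strictly beyond \<open>x\<close>: up to \<open>x\<close>
          the segment from \<open>p\<close> runs in the relative interior. Hence
          \<open>1 / t\<close> is an admissible cone parameter for \<open>x\<close>.\<close>
        have "\<not> t \<le> 1"
        proof
          assume "t \<le> 1"
          then have "p + t *\<^sub>R (x - p) \<in> rel_interior S"
            using shrink[of x t] x t(1) rel_interior_subset by (cases "t = 1") auto
          then show False using t(2) fr by blast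
        qed
        then show ?thesis
          unfolding open_cone_def using t
          by (auto intro!: exI[of _ "1 / t"] exI[of _ "p + t *\<^sub>R (x - p)"])
      qed (simp add: open_cone_def)
    qed
  qed
qed

section \<open>Faces of simplices and stars of vertices\<close>

text \<open>A point off the relative interior lies in a proper face, whose dimension is smaller;
  descend. The face found is the carrier of \<open>x\<close>.\<close>

lemma polytope_face_carrier:
  fixes P :: "'a::euclidean_space set"
  assumes "polytope P" "x \<in> P"
  shows "\<exists>F. F face_of P \<and> x \<in> rel_interior F"
  using assms
proof (induction "nat (aff_dim P)" arbitrary: P rule: less_induct)
  case less
  show ?case
  proof (cases "x \<in> rel_interior P")
    case True
    then show ?thesis using face_of_refl polytope_imp_convex less.prems by blast
  next
    case False
    then have "x \<in> rel_frontier P"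
      using less.prems polytope_imp_closed[of P] by (simp add: rel_frontier_def closure_closed)
    then obtain G where G: "G face_of P" "G \<noteq> P" "x \<in> G"
      using rel_frontier_of_polyhedron_alt[OF polytope_imp_polyhedron[OF less.prems(1)]] by auto
    have "aff_dim G < aff_dim P"
      using face_of_aff_dim_lt polytope_imp_convex less.prems(1) G by blast
    moreover have "0 \<le> aff_dim G" using G(3) aff_dim_negative_iff[of G] by (metis empty_iff not_le)
    ultimately have "nat (aff_dim G) < nat (aff_dim P)" by simp
    moreover have "polytope G" using face_of_polytope_polytope less.prems(1) G by blast
    ultimately obtain F where "F face_of G" "x \<in> rel_interior F" using less.hyps G by blast
    then show ?thesis using face_of_trans G by blast
  qed
qed

lemma convex_hull_subset_iff:
  assumes C: "\<not> affine_dependent C" and "U \<subseteq> C" "c \<subseteq> C"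
  shows "convex hull U \<subseteq> convex hull c \<longleftrightarrow> U \<subseteq> c"
proof
  assume L: "convex hull U \<subseteq> convex hull c"
  show "U \<subseteq> c"
  proof
    fix x assume x: "x \<in> U"
    show "x \<in> c"
    proof (rule ccontr)
      assume "x \<notin> c"
      then have "c \<subseteq> C - {x}" using assms by blast
      then have "x \<in> affine hull (C - {x})"
        using L x hull_inc[of x U] convex_hull_subset_affine_hull[of c] hull_mono[of c "C - {x}" affine]
        by blast
      then show False using C x assms(2) unfolding affine_dependent_def by blast
    qed
  qed
qed (rule hull_mono)

lemma bij_betw_simplex_faces:
  fixes C :: "'a::euclidean_space set"
  assumes "\<not> affine_dependent C"
  shows "bij_betw (\<lambda>U. convex hull U) {U. U \<subseteq> C} {G. G face_of (convex hull C)}"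
  unfolding bij_betw_def
proof
  show "inj_on (\<lambda>U. convex hull U) {U. U \<subseteq> C}"
    using convex_hull_subset_iff[OF assms] by (intro inj_onI) (metis mem_Collect_eq order_refl subset_antisym)
  show "(\<lambda>U. convex hull U) ` {U. U \<subseteq> C} = {G. G face_of (convex hull C)}"
    using face_of_convex_hull_affine_independent[OF assms] by auto
qed

lemma aff_dim_convex_hull_independent:
  assumes "\<not> affine_dependent C" "U \<subseteq> C"
  shows "aff_dim (convex hull U) = int (card U) - 1"
  using assms affine_independent_subset affine_independent_iff_card by (metis aff_dim_convex_hull)

text \<open>In a nontrivial interval of the subset lattice, even and odd cardinalities are equally
  frequent.\<close>

lemma sum_supersets_alternating:
  assumes "finite C" "U \<subseteq> C"
  shows "(\<Sum>c | U \<subseteq> c \<and> c \<subseteq> C. (-1) ^ card c) = (if U = C then (-1) ^ card C else (0::int))"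
proof (cases "U = C")
  case True
  then have "{c. U \<subseteq> c \<and> c \<subseteq> C} = {C}" by auto
  then show ?thesis using True by simp
next
  case False
  then have "U \<subset> C" using assms by blast
  have "(\<Sum>c | U \<subseteq> c \<and> c \<subseteq> C. (-1) ^ card c) = (0::int)"
  proof (rule sum_alternating_cancels)
    show "finite {c. U \<subseteq> c \<and> c \<subseteq> C}"
      using assms by (auto intro: finite_subset[of _ "Pow C"])
    show "card {x \<in> {c. U \<subseteq> c \<and> c \<subseteq> C}. even (card x)} = card {x \<in> {c. U \<subseteq> c \<and> c \<subseteq> C}. odd (card x)}"
      using card_subsupersets_even_odd[OF assms(1) \<open>U \<subset> C\<close>] by (simp add: conj_ac)
  qed
  then show ?thesis using False by simp
qed

lemma dissection_faces:
  fixes S :: "'a::euclidean_space set"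
  assumes "polytope S"
  shows "dissection {G. G face_of S \<and> G \<noteq> {}} (\<lambda>G. G) S"
  unfolding dissection_def
proof (intro conjI ballI)
  show "finite {G. G face_of S \<and> G \<noteq> {}}"
    using finite_polytope_faces[OF assms] by (rule finite_subset[rotated]) blast
  show "disjoint_family_on (\<lambda>G. rel_interior G) {G. G face_of S \<and> G \<noteq> {}}"
    unfolding disjoint_family_on_def using face_of_eq by blast
  show "(\<Union>G\<in>{G. G face_of S \<and> G \<noteq> {}}. rel_interior G) = S"
  proof
    show "S \<subseteq> (\<Union>G\<in>{G. G face_of S \<and> G \<noteq> {}}. rel_interior G)"
      using polytope_face_carrier[OF assms] by fastforce
    show "(\<Union>G\<in>{G. G face_of S \<and> G \<noteq> {}}. rel_interior G) \<subseteq> S"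
      using rel_interior_subset face_of_imp_subset by blast
  qed
qed (use assms face_of_polytope_polytope in blast)+

lemma nat_aff_dim_sign:
  assumes "G \<noteq> {}" "aff_dim G = int k - 1"
  shows "(-1 :: int) ^ nat (aff_dim G) = - ((-1) ^ k)"
proof -
  have "k \<ge> 1" using assms aff_dim_negative_iff[of G] by linarith
  then obtain m where "k = Suc m" by (cases k) auto
  then show ?thesis using assms by simp
qed

text \<open>The predicate \<open>P\<close> selects the faces above the one spanned by
  \<open>U\<close>. The empty \<open>U\<close> gives the total sum, the vertex set of a carrier
  gives a local sum. The first term corrects for the excluded empty face; the sign of the second
  comes from dimension being cardinality minus one.\<close>

lemma sum_simplex_faces:
  fixes C :: "'a::euclidean_space set"
  assumes C: "\<not> affine_dependent C" and U: "U \<subseteq> C" and P: "\<And>c. c \<subseteq> C \<Longrightarrow> P (convex hull c) \<longleftrightarrow> U \<subseteq> c"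
  shows "(\<Sum>G | G face_of (convex hull C) \<and> G \<noteq> {} \<and> P G. (-1) ^ nat (aff_dim G))
    = (if U = {} then 1 else 0) - (if U = C then (-1) ^ card C else (0::int))"
proof -
  have finC: "finite C" using C aff_independent_finite by blast
  let ?A = "{c. U \<subseteq> c \<and> c \<subseteq> C}"
  have finA: "finite ?A" using finC by (auto intro: finite_subset[of _ "Pow C"])
  have "{G. G face_of (convex hull C) \<and> G \<noteq> {} \<and> P G} = (\<lambda>c. convex hull c) ` (?A - {{}})"
  proof (intro set_eqI iffI)
    fix G assume G: "G \<in> {G. G face_of (convex hull C) \<and> G \<noteq> {} \<and> P G}"
    then obtain c where "c \<subseteq> C" "G = convex hull c"
      using face_of_convex_hull_affine_independent[OF C] by blast
    then show "G \<in> (\<lambda>c. convex hull c) ` (?A - {{}})" using G P by auto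
  next
    fix G assume "G \<in> (\<lambda>c. convex hull c) ` (?A - {{}})"
    then obtain c where "U \<subseteq> c" "c \<subseteq> C" "c \<noteq> {}" "G = convex hull c" by blast
    then show "G \<in> {G. G face_of (convex hull C) \<and> G \<noteq> {} \<and> P G}"
      using P face_of_convex_hull_affine_independent[OF C] by auto
  qed
  moreover have "inj_on (\<lambda>c. convex hull c) (?A - {{}})"
    using bij_betw_simplex_faces[OF C] by (auto simp: bij_betw_def elim!: inj_on_subset)
  ultimately have "(\<Sum>G | G face_of (convex hull C) \<and> G \<noteq> {} \<and> P G. (-1) ^ nat (aff_dim G))
      = (\<Sum>c\<in>?A - {{}}. (-1) ^ nat (aff_dim (convex hull c)) :: int)"
    by (simp add: sum.reindex)
  also have "\<dots> = (\<Sum>c\<in>?A - {{}}. - ((-1) ^ card c))"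
    using aff_dim_convex_hull_independent[OF C] by (intro sum.cong refl nat_aff_dim_sign) auto
  also have "\<dots> = - ((\<Sum>c\<in>?A. (-1) ^ card c) - (if {} \<in> ?A then 1 else 0))"
    using finA by (simp add: sum_negf sum_diff1)
  also have "\<dots> = (if U = {} then 1 else 0) - (if U = C then (-1) ^ card C else 0)"
    using sum_supersets_alternating[OF finC U] by auto
  finally show ?thesis .
qed

text \<open>The faces through \<open>y\<close> are those above the carrier of \<open>y\<close>, and
  this interval is trivial exactly when the carrier is all of \<open>S\<close>.\<close>

lemma euler_simplex:
  fixes S :: "'a::euclidean_space set"
  assumes "n simplex S" "n \<ge> 0"
  shows "(\<Sum>G | G face_of S \<and> G \<noteq> {}. (-1) ^ nat (aff_dim G) :: int) = 1"
    and "y \<in> S \<Longrightarrow> local_euler {G. G face_of S \<and> G \<noteq> {}} (\<lambda>G. G) y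
      = (if y \<in> rel_interior S then (-1) ^ nat n else 0)"
proof -
  obtain C where C: "\<not> affine_dependent C" "int (card C) = n + 1" "S = convex hull C"
    using assms(1) by (auto simp: simplex_def)
  have "C \<noteq> {}" using C assms(2) by auto
  then show "(\<Sum>G | G face_of S \<and> G \<noteq> {}. (-1) ^ nat (aff_dim G) :: int) = 1"
    using sum_simplex_faces[OF C(1), of "{}" "\<lambda>_. True"] C(3) by simp
  assume y: "y \<in> S"
  obtain F where F: "F face_of S" "y \<in> rel_interior F"
    using polytope_face_carrier[OF simplex_imp_polytope[OF assms(1)] y] by blast
  obtain U where U: "U \<subseteq> C" "F = convex hull U"
    using F face_of_convex_hull_affine_independent[OF C(1)] C(3) by blast
  have Une: "U \<noteq> {}" using U F by auto
  have yin: "y \<in> convex hull c \<longleftrightarrow> U \<subseteq> c" if "c \<subseteq> C" for c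
  proof -
    have cf: "convex hull c face_of S"
      using that face_of_convex_hull_affine_independent[OF C(1)] C(3) by blast
    have "y \<in> convex hull c \<longleftrightarrow> F \<subseteq> convex hull c"
      using subset_of_face_of[OF cf face_of_imp_subset[OF F(1)]] F(2) rel_interior_subset by blast
    then show ?thesis using convex_hull_subset_iff[OF C(1) U(1) that] U(2) by simp
  qed
  have "y \<in> rel_interior S \<longleftrightarrow> U = C"
  proof
    assume "y \<in> rel_interior S"
    then have "F = S"
      using face_of_eq[OF F(1) face_of_refl] F(2) convex_simplex[OF assms(1)] by blast
    then have "convex hull C \<subseteq> convex hull U" using U(2) C(3) by simp
    then show "U = C" using convex_hull_subset_iff[OF C(1) order_refl U(1)] U(1) by blast
  qed (use F U C in simp)
  moreover have "card C = Suc (nat n)" using C(2) assms(2) by linarith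
  ultimately show "local_euler {G. G face_of S \<and> G \<noteq> {}} (\<lambda>G. G) y
      = (if y \<in> rel_interior S then (-1) ^ nat n else 0)"
    using sum_simplex_faces[OF C(1) U(1), of "\<lambda>G. y \<in> G"] yin Une C(3)
    by (simp add: local_euler_def conj_ac)
qed

text \<open>Deleting the top cell subtracts (-1)^n from the total and from every local sum. For
  \<open>n = 0\<close> the frontier and the family of cells are empty.\<close>

lemma euler_simplex_frontier:
  fixes S :: "'a::euclidean_space set"
  assumes S: "n simplex S" "n \<ge> 0"
  defines "\<F> \<equiv> {G. G face_of S \<and> G \<noteq> {} \<and> G \<noteq> S}"
  shows "dissection \<F> (\<lambda>G. G) (rel_frontier S)"
    and "(\<Sum>G\<in>\<F>. (-1) ^ nat (aff_dim G) :: int) = 1 - (-1) ^ nat n"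
    and "y \<in> rel_frontier S \<Longrightarrow> local_euler \<F> (\<lambda>G. G) y = - ((-1) ^ nat n)"
proof -
  let ?G = "{G. G face_of S \<and> G \<noteq> {}}"
  have Sne: "S \<noteq> {}" using assms by auto
  have poly: "polytope S" using S simplex_imp_polytope by blast
  have cv: "convex S" using S convex_simplex by blast
  have dis: "dissection ?G (\<lambda>G. G) S" using dissection_faces[OF poly] .
  have SG: "S \<in> ?G" using Sne cv face_of_refl by blast
  have \<F>: "\<F> = ?G - {S}" by (auto simp: \<F>_def)
  have finG: "finite ?G" using dis by (simp add: dissection_def)
  have disj: "rel_interior G \<inter> rel_interior S = {}" if "G \<in> \<F>" for G
    using that face_of_disjoint_rel_interior[of G S] rel_interior_subset by (auto simp: \<F>_def)
  have "(\<Union>G\<in>?G. rel_interior G) = S" using dis by (simp add: dissection_def)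
  then have "(\<Union>G\<in>\<F>. rel_interior G) = S - rel_interior S"
    using disj SG unfolding \<F> by blast
  also have "\<dots> = rel_frontier S"
    using poly by (simp add: rel_frontier_def polytope_imp_closed)
  finally have "(\<Union>G\<in>\<F>. rel_interior G) = rel_frontier S" .
  moreover have "disjoint_family_on (\<lambda>G. rel_interior G) \<F>"
    using dis disjoint_family_on_mono[of \<F> ?G] unfolding dissection_def \<F> by blast
  moreover have "finite \<F>" "\<forall>G\<in>\<F>. polytope G \<and> G \<noteq> {}"
    using dis unfolding dissection_def \<F> by blast+
  ultimately show "dissection \<F> (\<lambda>G. G) (rel_frontier S)"
    by (simp add: dissection_def)
  have dimS: "aff_dim S = n" using S aff_dim_simplex by blast
  show "(\<Sum>G\<in>\<F>. (-1) ^ nat (aff_dim G) :: int) = 1 - (-1) ^ nat n"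
    using euler_simplex(1)[OF S] SG finG unfolding \<F> by (simp add: sum_diff1 dimS)
  assume y: "y \<in> rel_frontier S"
  then have y': "y \<in> S" "y \<notin> rel_interior S"
    using poly by (auto simp: rel_frontier_def polytope_imp_closed)
  have "{G \<in> \<F>. y \<in> G} = {G \<in> ?G. y \<in> G} - {S}" by (auto simp: \<F>)
  then have "local_euler \<F> (\<lambda>G. G) y = local_euler ?G (\<lambda>G. G) y - (-1) ^ nat n"
    using SG finite_subset[OF _ finG, of "{G \<in> ?G. y \<in> G}"] y' unfolding local_euler_def
    by (simp add: sum_diff1 dimS del: mem_Collect_eq) auto
  then show "local_euler \<F> (\<lambda>G. G) y = - ((-1) ^ nat n)"
    using euler_simplex(2)[OF S y'(1)] y' by simp
qed

text \<open>Injectivity is known only on \<open>P\<close>, and the linear part \<open>h\<close> may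
  have a kernel. The dimension is therefore compared through a homeomorphism of compact convex
  sets.\<close>

lemma affine_image_polytope:
  fixes f :: "'a::euclidean_space \<Rightarrow> 'b::euclidean_space"
  assumes f: "affine_map_on P f" "inj_on f P" and P: "polytope P"
  shows "polytope (f ` P)" "rel_interior (f ` P) = f ` rel_interior P" "aff_dim (f ` P) = aff_dim P"
proof -
  obtain h c where h: "linear h" "\<And>x. x \<in> P \<Longrightarrow> f x = h x + c"
    using f by (auto simp: affine_map_on_def)
  have eq: "f ` Q = (+) c ` h ` Q" if "Q \<subseteq> P" for Q
    using that h(2) by (force simp: image_image add.commute)
  have cv: "convex P" using P polytope_imp_convex by blast
  show poly: "polytope (f ` P)"
    unfolding eq[OF order_refl] using P h(1) by (simp add: polytope_translation_eq polytope_linear_image)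
  show "rel_interior (f ` P) = f ` rel_interior P"
    unfolding eq[OF order_refl] eq[OF rel_interior_subset]
    using rel_interior_convex_linear_image[OF h(1) cv] by (simp add: rel_interior_translation)
  have "continuous_on P (\<lambda>x. h x + c)"
    using h(1) by (intro continuous_intros linear_continuous_on) (simp add: linear_conv_bounded_linear)
  then have "continuous_on P f" using h(2) by (metis (no_types, lifting) continuous_on_cong)
  then have "P homeomorphic f ` P"
    using f(2) P by (intro homeomorphic_compact polytope_imp_compact) auto
  then show "aff_dim (f ` P) = aff_dim P"
    using homeomorphic_convex_compact_sets_eq[of P "f ` P"] P poly polytope_imp_convex polytope_imp_compact
    by metis
qed

lemma dissection_image:
  fixes f :: "'a::euclidean_space \<Rightarrow> 'b::euclidean_space"
  assumes dis: "dissection I c L" and sub: "\<And>i. i \<in> I \<Longrightarrow> c i \<subseteq> L"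
    and f: "inj_on f L" "\<And>i. i \<in> I \<Longrightarrow> affine_map_on (c i) f"
  shows "dissection I (\<lambda>i. f ` c i) (f ` L)"
    and "(\<Sum>i\<in>I. (-1) ^ nat (aff_dim (f ` c i)) :: int) = (\<Sum>i\<in>I. (-1) ^ nat (aff_dim (c i)))"
    and "z \<in> L \<Longrightarrow> local_euler I (\<lambda>i. f ` c i) (f z) = local_euler I c z"
proof -
  have inj: "inj_on f (c i)" if "i \<in> I" for i using f(1) sub that inj_on_subset by blast
  have poly: "polytope (c i)" if "i \<in> I" for i using dis that by (auto simp: dissection_def)
  note im = affine_image_polytope[OF f(2) inj poly]
  have riL: "rel_interior (c i) \<subseteq> L" if "i \<in> I" for i using dis that by (auto simp: dissection_def)
  show "dissection I (\<lambda>i. f ` c i) (f ` L)"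
    unfolding dissection_def
  proof (intro conjI)
    show "disjoint_family_on (\<lambda>i. rel_interior (f ` c i)) I"
      unfolding disjoint_family_on_def
    proof (intro ballI impI)
      fix i j assume ij: "i \<in> I" "j \<in> I" "i \<noteq> j"
      then have "rel_interior (c i) \<inter> rel_interior (c j) = {}"
        using dis by (auto simp: dissection_def disjoint_family_on_def)
      then have "f ` rel_interior (c i) \<inter> f ` rel_interior (c j) = {}"
        using inj_on_image_Int[OF f(1) riL riL] ij by (metis image_empty)
      then show "rel_interior (f ` c i) \<inter> rel_interior (f ` c j) = {}"
        using im(2) ij by simp
    qed
    have "(\<Union>i\<in>I. rel_interior (f ` c i)) = (\<Union>i\<in>I. f ` rel_interior (c i))" using im(2) by simp
    also have "\<dots> = f ` L" using dis by (auto simp: dissection_def)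
    finally show "(\<Union>i\<in>I. rel_interior (f ` c i)) = f ` L" .
  qed (use dis im(1) in \<open>auto simp: dissection_def\<close>)
  show "(\<Sum>i\<in>I. (-1) ^ nat (aff_dim (f ` c i)) :: int) = (\<Sum>i\<in>I. (-1) ^ nat (aff_dim (c i)))"
    using im(3) by simp
  assume z: "z \<in> L"
  have "{i \<in> I. f z \<in> f ` c i} = {i \<in> I. z \<in> c i}"
    using f(1) z sub by (auto simp: inj_on_def)
  then show "local_euler I (\<lambda>i. f ` c i) (f z) = local_euler I c z"
    unfolding local_euler_def using im(3) by simp
qed

section \<open>Vertex links and open stars in a simplicial complex\<close>

context
  fixes M :: "'a::euclidean_space set set"
  assumes M: "simplicial_complex M"
begin

lemma complex_finite: "finite M"
  and complex_simplex: "S \<in> M \<Longrightarrow> \<exists>n. n simplex S"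
  and complex_face: "S \<in> M \<Longrightarrow> F face_of S \<Longrightarrow> F \<in> M"
  and complex_Int: "S \<in> M \<Longrightarrow> T \<in> M \<Longrightarrow> S \<inter> T face_of S"
  using M by (auto simp: simplicial_complex_def)

lemma complex_polytope: "S \<in> M \<Longrightarrow> polytope S"
  using complex_simplex simplex_imp_polytope by blast

text \<open>\<open>S \<inter> T\<close> is a face of \<open>S\<close> that contains a relative
  interior point of \<open>S\<close>, hence all of \<open>S\<close>.\<close>

lemma complex_carrier_subset:
  assumes "S \<in> M" "T \<in> M" "x \<in> rel_interior S" "x \<in> T"
  shows "S \<subseteq> T"
  using subset_of_face_of[OF complex_Int[OF assms(1,2)] order_refl] assms(3,4) rel_interior_subset by blast

lemma complex_subset_face: "S \<in> M \<Longrightarrow> T \<in> M \<Longrightarrow> S \<subseteq> T \<Longrightarrow> S face_of T"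
  using complex_Int[of T S] by (simp add: inf.absorb2)

lemma complex_dissection: "dissection (M - {{}}) (\<lambda>S. S) (\<Union>M)"
  unfolding dissection_def
proof (intro conjI)
  show "disjoint_family_on (\<lambda>S. rel_interior S) (M - {{}})"
    unfolding disjoint_family_on_def
  proof (intro ballI impI)
    fix S T assume ST: "S \<in> M - {{}}" "T \<in> M - {{}}" "S \<noteq> T"
    have False if x: "x \<in> rel_interior S" "x \<in> rel_interior T" for x
    proof -
      have "S \<subseteq> T" "T \<subseteq> S"
        using complex_carrier_subset[of S T x] complex_carrier_subset[of T S x] ST x rel_interior_subset
        by blast+
      then show False using ST(3) by blast
    qed
    then show "rel_interior S \<inter> rel_interior T = {}" by blast
  qed
  show "(\<Union>S\<in>M - {{}}. rel_interior S) = \<Union>M"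
  proof
    show "\<Union>M \<subseteq> (\<Union>S\<in>M - {{}}. rel_interior S)"
      using polytope_face_carrier complex_polytope complex_face by fastforce
    show "(\<Union>S\<in>M - {{}}. rel_interior S) \<subseteq> \<Union>M" using rel_interior_subset by blast
  qed
qed (use complex_finite complex_polytope in auto)

lemma complex_compact: "compact (\<Union>M)"
  using complex_finite complex_polytope polytope_imp_compact by (intro compact_Union) auto

text \<open>Since \<open>{v}\<close> is a face of \<open>S\<close>, it is spanned by some of the
  vertices of \<open>S\<close>, so \<open>v\<close> is one of them.\<close>

lemma star_cell:
  assumes "{v} \<in> M" "S \<in> M" "v \<in> S"
  obtains C where "S = convex hull (insert v C)" "v \<notin> C" "\<not> affine_dependent (insert v C)"
proof -
  obtain D where D: "\<not> affine_dependent D" "S = convex hull D"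
    using complex_simplex[OF assms(2)] by (auto simp: simplex_def)
  have "{v} face_of S" using complex_subset_face assms by simp
  then obtain c where c: "c \<subseteq> D" "{v} = convex hull c"
    using face_of_convex_hull_affine_independent[OF D(1)] D(2) by blast
  have "c \<noteq> {}" using c by auto
  moreover have "c \<subseteq> {v}" using c hull_subset[of c convex] by blast
  ultimately have "v \<in> D" using c by blast
  then have "insert v (D - {v}) = D" by blast
  then show ?thesis using that[of "D - {v}"] D by auto
qed

lemma vertex_link_subset: "vertex_link M v \<subseteq> M"
  by (auto simp: vertex_link_def)

lemma vertex_link_face: "T \<in> vertex_link M v \<Longrightarrow> F face_of T \<Longrightarrow> F \<in> vertex_link M v"
  unfolding vertex_link_def using complex_face face_of_trans face_of_imp_subset by blast

lemma vertex_link_join: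
  assumes v: "{v} \<in> M" and T: "T \<in> vertex_link M v"
  shows "convex hull (insert v T) \<in> M"
proof -
  obtain S where S: "S \<in> M" "v \<in> S" "T face_of S" "v \<notin> T"
    using T by (auto simp: vertex_link_def)
  obtain C where C: "S = convex hull (insert v C)" "v \<notin> C" "\<not> affine_dependent (insert v C)"
    using star_cell[OF v S(1,2)] .
  obtain c where c: "c \<subseteq> insert v C" "T = convex hull c"
    using S(3) face_of_convex_hull_affine_independent[OF C(3)] C(1) by blast
  have "convex hull (insert v T) = convex hull (insert v c)"
    unfolding c(2) by (rule hull_insert[symmetric])
  then have "convex hull (insert v T) face_of S"
    using face_of_convex_hull_affine_independent[OF C(3)] C(1) c(1) by blast
  then show ?thesis using complex_face S(1) by blast
qed

text \<open>\<open>T\<close> is the face spanned by the vertices other than \<open>v\<close>. For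
  \<open>S = {v}\<close> it is the empty simplex, which the link contains by convention.\<close>

lemma vertex_link_opposite:
  assumes v: "{v} \<in> M" and S: "S \<in> M" "v \<in> S"
  obtains T where "T \<in> vertex_link M v" "S = convex hull (insert v T)"
proof -
  obtain C where C: "S = convex hull (insert v C)" "v \<notin> C" "\<not> affine_dependent (insert v C)"
    using star_cell[OF v S] .
  have face: "convex hull C face_of S"
    using face_of_convex_hull_affine_independent[OF C(3)] C(1) by blast
  have "v \<notin> convex hull C"
    using C(2,3) convex_hull_subset_affine_hull[of C] unfolding affine_dependent_def
    by (metis Diff_insert_absorb insertI1 subsetD)
  then have "convex hull C \<in> vertex_link M v"
    unfolding vertex_link_def using face S complex_face by blast
  moreover have "S = convex hull (insert v (convex hull C))"
    unfolding C(1) by (rule hull_insert)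
  ultimately show ?thesis using that by blast
qed

lemma vertex_link_carrier:
  assumes "y \<in> \<Union>(vertex_link M v)"
  obtains T where "T \<in> vertex_link M v" "y \<in> rel_interior T"
  using assms polytope_face_carrier complex_polytope vertex_link_subset vertex_link_face by blast

text \<open>Suppose \<open>y\<close> and a point strictly between \<open>v\<close> and
  \<open>y\<close> both lie in the link. That point is in the relative interior of the join of
  \<open>v\<close> with the carrier of \<open>y\<close>, so any link simplex through it contains the
  whole join, and with it \<open>v\<close>. For c > 1 the two points exchange roles.\<close>

lemma vertex_link_cone_position:
  assumes v: "{v} \<in> M"
  shows "cone_position v (\<Union>(vertex_link M v))"
proof -
  let ?L = "\<Union>(vertex_link M v)"
  have vn: "v \<notin> ?L" by (auto simp: vertex_link_def)
  have less: "False" if y: "y \<in> ?L" and z: "v + c *\<^sub>R (y - v) \<in> ?L" and c: "0 < c" "c < 1" for y c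
  proof -
    obtain T where T: "T \<in> vertex_link M v" "y \<in> rel_interior T" using vertex_link_carrier[OF y] .
    have cv: "convex T" "T \<noteq> {}"
      using T complex_polytope vertex_link_subset polytope_imp_convex rel_interior_empty by blast+
    have "v + c *\<^sub>R (y - v) \<in> rel_interior (convex hull (insert v T))"
      using c T(2) unfolding rel_interior_convex_hull_insert_cone[OF cv] by blast
    moreover obtain S where S: "S \<in> vertex_link M v" "v + c *\<^sub>R (y - v) \<in> S" using z by blast
    ultimately have "convex hull (insert v T) \<subseteq> S"
      using complex_carrier_subset vertex_link_join[OF v T(1)] vertex_link_subset by blast
    then have "v \<in> S" using hull_inc[of v "insert v T"] by blast
    then show False using S by (auto simp: vertex_link_def)
  qed
  show ?thesis
    unfolding cone_position_def
  proof (intro conjI ballI allI impI)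
    fix y z c assume y: "y \<in> ?L" and z: "z \<in> ?L" and c: "(0::real) < c" and eq: "z - v = c *\<^sub>R (y - v)"
    have zeq: "z = v + c *\<^sub>R (y - v)" using eq by (simp add: algebra_simps)
    have "(1 / c) *\<^sub>R (z - v) = y - v" using eq c by simp
    then have yeq: "y = v + (1 / c) *\<^sub>R (z - v)" by simp
    have "\<not> c < 1" using less[OF y] z zeq c by blast
    moreover have "\<not> c > 1" using less[OF z, of "1 / c"] y yeq c by auto
    ultimately show "z = y" using zeq by (cases "c = 1") auto
  qed (use vn in blast)
qed

text \<open>Links the combinatorial star with the cone over the link: other triangulations of the
  link's underlying set, once coned, dissect the same open star and can be compared with this
  one.\<close>

lemma star_dissection:
  assumes v: "{v} \<in> M"
  shows "dissection {S \<in> M. v \<in> S} (\<lambda>S. S) (open_cone v (\<Union>(vertex_link M v)))"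
proof -
  let ?L = "\<Union>(vertex_link M v)" and ?I = "{S \<in> M. v \<in> S}"
  have "(\<Union>S\<in>?I. rel_interior S) = open_cone v ?L"
  proof
    show "(\<Union>S\<in>?I. rel_interior S) \<subseteq> open_cone v ?L"
    proof
      fix x assume "x \<in> (\<Union>S\<in>?I. rel_interior S)"
      then obtain S where S: "S \<in> M" "v \<in> S" "x \<in> rel_interior S" by blast
      obtain T where T: "T \<in> vertex_link M v" "S = convex hull (insert v T)"
        using vertex_link_opposite[OF v S(1,2)] .
      show "x \<in> open_cone v ?L"
      proof (cases "T = {}")
        case True
        then show ?thesis using S T by (simp add: open_cone_def)
      next
        case False
        have "convex T" using T complex_polytope vertex_link_subset polytope_imp_convex by blast
        then show ?thesis
          using S(3) T rel_interior_subset[of T] False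
          unfolding T(2) rel_interior_convex_hull_insert_cone[OF \<open>convex T\<close> False] open_cone_def by blast
      qed
    qed
    show "open_cone v ?L \<subseteq> (\<Union>S\<in>?I. rel_interior S)"
    proof
      fix x assume "x \<in> open_cone v ?L"
      then consider "x = v" | t y where "x = v + t *\<^sub>R (y - v)" "0 < t" "t < 1" "y \<in> ?L"
        by (auto simp: open_cone_def)
      then show "x \<in> (\<Union>S\<in>?I. rel_interior S)"
      proof cases
        case 1
        then show ?thesis using v by (intro UN_I[of "{v}"]) auto
      next
        case 2
        obtain T where T: "T \<in> vertex_link M v" "y \<in> rel_interior T" using vertex_link_carrier[OF 2(4)] .
        have cv: "convex T" "T \<noteq> {}"
          using T complex_polytope vertex_link_subset polytope_imp_convex rel_interior_empty by blast+
        have "x \<in> rel_interior (convex hull (insert v T))"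
          using 2 T(2) unfolding rel_interior_convex_hull_insert_cone[OF cv] by blast
        moreover have "v \<in> convex hull (insert v T)" by (simp add: hull_inc)
        ultimately show ?thesis using vertex_link_join[OF v T(1)] by blast
      qed
    qed
  qed
  moreover have "disjoint_family_on (\<lambda>S. rel_interior S) ?I"
    using complex_dissection disjoint_family_on_mono[of ?I "M - {{}}"] unfolding dissection_def by blast
  ultimately show ?thesis
    using complex_finite complex_polytope by (auto simp: dissection_def)
qed

text \<open>The complement is the union of the finitely many simplices that avoid \<open>v\<close>,
  since a simplex contains \<open>v\<close> as soon as it meets the relative interior of a simplex
  through \<open>v\<close>.\<close>

lemma openin_star:
  assumes v: "{v} \<in> M"
  shows "openin (top_of_set (\<Union>M)) (open_cone v (\<Union>(vertex_link M v)))"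
proof -
  let ?W = "open_cone v (\<Union>(vertex_link M v))" and ?R = "\<Union>{S \<in> M. v \<notin> S}"
  have W: "?W = (\<Union>S\<in>{S \<in> M. v \<in> S}. rel_interior S)"
    using star_dissection[OF v] by (simp add: dissection_def)
  have "closed ?R"
    using complex_finite complex_polytope polytope_imp_closed by (intro closed_Union) auto
  moreover have "?W = \<Union>M - ?R"
  proof
    show "?W \<subseteq> \<Union>M - ?R"
      unfolding W using complex_carrier_subset rel_interior_subset by blast
    show "\<Union>M - ?R \<subseteq> ?W"
    proof
      fix x assume x: "x \<in> \<Union>M - ?R"
      then obtain S where S: "S \<in> M" "x \<in> rel_interior S"
        using complex_dissection unfolding dissection_def by blast
      then show "x \<in> ?W" unfolding W using x rel_interior_subset by blast
    qed
  qed
  ultimately show ?thesis by (simp add: openin_diff closed_subset Diff_subset closedin_closed_Int openin_open_Int Diff_eq open_Compl)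
qed

lemma simplex_vertex:
  assumes "S \<in> M" "S \<noteq> {}"
  obtains v where "v \<in> S" "{v} \<in> M"
proof -
  obtain C where C: "\<not> affine_dependent C" "S = convex hull C"
    using complex_simplex[OF assms(1)] by (auto simp: simplex_def)
  then obtain v where v: "v \<in> C" using assms(2) by fastforce
  then have "convex hull {v} face_of S"
    using face_of_convex_hull_affine_independent[OF C(1)] C(2) by blast
  then have "{v} \<in> M" using complex_face[OF assms(1)] by simp
  then show ?thesis using that[of v] v C(2) hull_inc by metis
qed

lemma card_simplex_faces:
  assumes R: "R \<in> M" "int j simplex R"
  shows "card {S \<in> M. int k simplex S \<and> S \<subseteq> R} = (Suc j choose Suc k)"
proof -
  obtain C where C: "\<not> affine_dependent C" "int (card C) = int j + 1" "R = convex hull C"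
    using R(2) by (auto simp: simplex_def)
  have card: "card C = Suc j" and fin: "finite C" using C(1,2) aff_independent_finite by auto
  have "{S \<in> M. int k simplex S \<and> S \<subseteq> R} = (\<lambda>U. convex hull U) ` {U. U \<subseteq> C \<and> card U = Suc k}"
  proof (intro set_eqI iffI)
    fix S assume S: "S \<in> {S \<in> M. int k simplex S \<and> S \<subseteq> R}"
    then have "S face_of convex hull C"
      using complex_subset_face[OF _ R(1)] C(3) by simp
    then obtain U where U: "U \<subseteq> C" "S = convex hull U"
      using face_of_convex_hull_affine_independent[OF C(1)] by blast
    have "aff_dim S = int k" using S aff_dim_simplex by blast
    then have "card U = Suc k" using aff_dim_convex_hull_independent[OF C(1) U(1)] U(2) by simp
    then show "S \<in> (\<lambda>U. convex hull U) ` {U. U \<subseteq> C \<and> card U = Suc k}" using U by blast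
  next
    fix S assume "S \<in> (\<lambda>U. convex hull U) ` {U. U \<subseteq> C \<and> card U = Suc k}"
    then obtain U where U: "U \<subseteq> C" "card U = Suc k" "S = convex hull U" by blast
    have "int k simplex S"
      unfolding simplex_def using U affine_independent_subset[OF C(1)] by (intro exI[of _ U]) auto
    moreover have "S face_of R"
      using U face_of_convex_hull_affine_independent[OF C(1)] C(3) by blast
    ultimately show "S \<in> {S \<in> M. int k simplex S \<and> S \<subseteq> R}"
      using complex_face[OF R(1)] face_of_imp_subset by blast
  qed
  moreover have "inj_on (\<lambda>U. convex hull U) {U. U \<subseteq> C \<and> card U = Suc k}"
    using bij_betw_simplex_faces[OF C(1)] by (auto simp: bij_betw_def elim!: inj_on_subset)
  ultimately show ?thesis
    using n_subsets[OF fin, of "Suc k"] by (simp add: card_image card)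
qed

end

section \<open>Boundary points in a convex chart\<close>

lemma homeomorphic_imp_homeomorphic_space:
  assumes "S homeomorphic T"
  shows "top_of_set S homeomorphic_space top_of_set T"
proof -
  obtain f g where "homeomorphism S T f g" using assms by (auto simp: homeomorphic_def)
  then have "homeomorphic_maps (top_of_set S) (top_of_set T) f g"
    by (auto simp: homeomorphism_def homeomorphic_maps_def continuous_map_in_subtopology)
  then show ?thesis by (auto simp: homeomorphic_space_def)
qed

lemma homeomorphic_space_imp_homeomorphism:
  assumes "top_of_set S homeomorphic_space top_of_set T"
  obtains f g where "homeomorphism S T f g"
proof -
  obtain f g where "homeomorphic_maps (top_of_set S) (top_of_set T) f g"
    using assms by (auto simp: homeomorphic_space_def)
  then have "homeomorphism S T f g"
    by (intro homeomorphismI) (auto simp: homeomorphic_maps_def continuous_map_in_subtopology Pi_iff)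
  then show ?thesis using that by blast
qed

text \<open>\<open>Euclidean_space d\<close> consists of real sequences that vanish from index
  \<open>d\<close> on, so the homeomorphism is given by coordinates with respect to an orthonormal
  basis of the direction space.\<close>

lemma affine_homeomorphic_Euclidean_space:
  fixes A :: "'a::euclidean_space set"
  assumes A: "affine A" and d: "aff_dim A = int d"
  shows "top_of_set A homeomorphic_space Euclidean_space d"
proof -
  have "A \<noteq> {}" using d by auto
  then obtain a where a: "a \<in> A" by blast
  define V where "V = (\<lambda>x. x - a) ` A"
  have V: "subspace V" "V = (+) (- a) ` A"
    using affine_diffs_subspace[OF A a] by (auto simp: V_def)
  have "aff_dim V = int d" using d V aff_dim_translation_eq[of "-a" A] by simp
  then have dimV: "dim V = d"
    using aff_dim_subspace[OF V(1)] by simp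
  obtain B where B: "B \<subseteq> V" "pairwise orthogonal B" "\<And>x. x \<in> B \<Longrightarrow> norm x = 1"
    "independent B" "card B = dim V" "span B = V"
    using orthonormal_basis_subspace[OF V(1)] by metis
  have "finite B" using B(4) independent_imp_finite by blast
  then obtain b where b: "bij_betw b {..<d} B"
    using ex_bij_betw_nat_finite[of B] B(5) dimV by (auto simp: atLeast0LessThan)
  have ortho: "b i \<bullet> b j = (if i = j then 1 else 0)" if "i < d" "j < d" for i j
  proof (cases "i = j")
    case True
    then show ?thesis using B(3)[of "b i"] bij_betwE[OF b] that by (simp add: dot_square_norm)
  next
    case False
    then have "b i \<noteq> b j" using b that by (auto simp: bij_betw_def inj_on_def)
    then show ?thesis
      using B(2) bij_betwE[OF b] that False unfolding pairwise_def orthogonal_def by auto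
  qed
  define f where "f = (\<lambda>x i. if i < d then (x - a) \<bullet> b i else 0)"
  define g where "g = (\<lambda>y. a + (\<Sum>i<d. y i *\<^sub>R b i))"
  have gA: "g y \<in> A" for y
  proof -
    have "(\<Sum>i<d. y i *\<^sub>R b i) \<in> V"
      using V(1) B(1) bij_betwE[OF b]
      by (intro subspace_sum subspace_scale) auto
    then show ?thesis by (auto simp: g_def V_def)
  qed
  have gf: "g (f x) = x" if "x \<in> A" for x
  proof -
    have "x - a \<in> span B" using that by (auto simp: B(6) V_def)
    then obtain c where c: "x - a = (\<Sum>v\<in>B. c v *\<^sub>R v)"
      using span_finite[OF \<open>finite B\<close>] by auto
    have c': "x - a = (\<Sum>i<d. c (b i) *\<^sub>R b i)"
      unfolding c by (rule sum.reindex_bij_betw[OF b, symmetric])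
    have "(x - a) \<bullet> b i = c (b i)" if "i < d" for i
    proof -
      have "(x - a) \<bullet> b i = (\<Sum>j<d. c (b j) * (b j \<bullet> b i))"
        unfolding c' by (simp add: inner_sum_left)
      also have "\<dots> = (\<Sum>j<d. if j = i then c (b j) else 0)"
        using that ortho by (intro sum.cong) auto
      also have "\<dots> = c (b i)" using that by simp
      finally show ?thesis .
    qed
    then have "g (f x) = a + (\<Sum>i<d. c (b i) *\<^sub>R b i)"
      unfolding g_def f_def by simp
    then show ?thesis using c' by (metis add_diff_cancel_left' diff_add_cancel add.commute)
  qed
  have fg: "f (g y) = y" if "y \<in> topspace (Euclidean_space d)" for y
  proof
    fix i
    show "f (g y) i = y i"
    proof (cases "i < d")
      case True
      have "f (g y) i = (\<Sum>j<d. y j * (b j \<bullet> b i))"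
        using True by (simp add: f_def g_def inner_sum_left)
      also have "\<dots> = (\<Sum>j<d. if j = i then y j else 0)"
        using True ortho by (intro sum.cong) auto
      also have "\<dots> = y i" using True by simp
      finally show ?thesis .
    qed (use that in \<open>simp add: f_def topspace_Euclidean_space\<close>)
  qed
  have "continuous_map (top_of_set A) (Euclidean_space d) f"
    unfolding f_def continuous_map_componentwise_Euclidean_space
    by (auto intro!: continuous_intros)
  moreover have "continuous_map (Euclidean_space d) (top_of_set A) g"
    unfolding continuous_map_in_subtopology continuous_map_Euclidean_space_iff
    using gA by (auto simp: g_def
        intro!: continuous_intros continuous_on_subset[OF continuous_on_product_coordinates])
  ultimately have "homeomorphic_maps (top_of_set A) (Euclidean_space d) f g"
    unfolding homeomorphic_maps_def using gf fg by simp
  then show ?thesis by (auto simp: homeomorphic_space_def)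
qed

lemma subspace_Int_ball_homeomorphic:
  fixes V :: "'a::euclidean_space set"
  assumes V: "subspace V"
  shows "V \<inter> ball 0 1 homeomorphic V"
  unfolding homeomorphic_def
proof (intro exI homeomorphismI)
  let ?f = "\<lambda>z::'a. z /\<^sub>R (1 - norm z)" and ?g = "\<lambda>z::'a. z /\<^sub>R (1 + norm z)"
  have pos: "1 + norm z > 0" for z :: 'a by (simp add: add_pos_nonneg)
  have fV: "?f z \<in> V" "?g z \<in> V" if "z \<in> V" for z using V that by (auto simp: subspace_scale)
  have gf: "?g (?f z) = z" if "norm z < 1" for z
    using that by (simp add: field_split_simps)
  have ng: "norm (?g z) < 1" for z
    using pos[of z] by (simp add: field_split_simps)
  have fg: "?f (?g z) = z" for z
  proof -
    have "1 - norm (?g z) = 1 / (1 + norm z)"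
      using pos[of z] by (simp add: field_split_simps)
    then show ?thesis using pos[of z] by simp
  qed
  show "continuous_on (V \<inter> ball 0 1) ?f"
    by (intro continuous_intros) auto
  show "continuous_on V ?g"
    using pos by (intro continuous_intros) (metis less_irrefl)
  show "?f ` (V \<inter> ball 0 1) \<subseteq> V" using fV by auto
  show "?g ` V \<subseteq> V \<inter> ball 0 1" using fV ng by (auto simp del: norm_scaleR)
  show "?g (?f x) = x" if "x \<in> V \<inter> ball 0 1" for x using gf that by simp
  show "?f (?g y) = y" if "y \<in> V" for y using fg .
qed

lemma affine_Int_ball_homeomorphic:
  fixes A :: "'a::euclidean_space set"
  assumes A: "affine A" and a: "a \<in> A" and e: "e > 0"
  shows "A \<inter> ball a e homeomorphic A"
proof -
  define V where "V = (\<lambda>x. x - a) ` A"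
  have V: "subspace V" using affine_diffs_subspace[OF A a] by (auto simp: V_def)
  have inA: "a + x \<in> A \<longleftrightarrow> x \<in> V" for x
    unfolding V_def by (auto intro!: image_eqI[of _ _ "a + x"])
  have sc: "c *\<^sub>R x \<in> V \<longleftrightarrow> x \<in> V" if "c \<noteq> 0" for c x
    using V that subspace_scale[of V "c *\<^sub>R x" "inverse c"] by (auto simp: subspace_scale)
  have "A \<inter> ball a e homeomorphic V \<inter> ball 0 1"
    unfolding homeomorphic_def
  proof (intro exI homeomorphismI)
    let ?f = "\<lambda>x. (1 / e) *\<^sub>R (x - a)" and ?g = "\<lambda>x. a + e *\<^sub>R x"
    have f: "?f x \<in> V \<inter> ball 0 1" if "x \<in> A \<inter> ball a e" for x
      using that e sc[of "1 / e" "x - a"] inA[of "x - a"] by (auto simp: dist_norm norm_minus_commute)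
    have g: "?g x \<in> A \<inter> ball a e" if "x \<in> V \<inter> ball 0 1" for x
      using that e sc[of e x] inA[of "e *\<^sub>R x"] by (auto simp: dist_norm)
    have fg: "?f (?g x) = x" "?g (?f x) = x" for x using e by simp_all
    show "continuous_on (A \<inter> ball a e) ?f" "continuous_on (V \<inter> ball 0 1) ?g"
      by (intro continuous_intros)+
    show "?g (?f x) = x" "?f (?g x) = x" for x by (fact fg)+
    show "?f ` (A \<inter> ball a e) \<subseteq> V \<inter> ball 0 1" "?g ` (V \<inter> ball 0 1) \<subseteq> A \<inter> ball a e"
      using f g by blast+
  qed
  moreover have "V homeomorphic A"
  proof -
    have "A = (+) a ` V" by (auto simp: V_def image_image)
    then show ?thesis using homeomorphic_translation[of V a] by simp
  qed
  ultimately show ?thesis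
    using subspace_Int_ball_homeomorphic[OF V] homeomorphic_trans by blast
qed

text \<open>The image \<open>W'\<close> is only squeezed between \<open>rel_interior D\<close> and
  \<open>D\<close>, which covers both the open cell of a sphere link and the half-open cone of a
  ball link. A point sent to the relative interior has the preimage of a small ball as Euclidean
  neighbourhood. Conversely, a Euclidean neighbourhood is carried injectively into the affine hull
  of \<open>D\<close>, which has the same dimension \<open>d\<close>; by invariance of domain its
  image is open there and so lies in \<open>rel_interior D\<close>.\<close>

lemma manifold_boundary_chart:
  fixes X :: "'a::euclidean_space set" and D :: "'b::euclidean_space set"
  assumes W: "openin (top_of_set X) W" and hom: "homeomorphism W W' F G"
    and D: "aff_dim D = int d" "rel_interior D \<subseteq> W'" "W' \<subseteq> D" and x: "x \<in> W"
  shows "x \<in> manifold_boundary d X \<longleftrightarrow> F x \<notin> rel_interior D"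
proof -
  define A where "A = affine hull D"
  have A: "affine A" "aff_dim A = int d" and DA: "D \<subseteq> A"
    using D by (auto simp: A_def hull_subset)
  have xX: "x \<in> X" and WX: "W \<subseteq> X" using W x openin_imp_subset by blast+
  have F: "continuous_on W F" "F ` W = W'" "inj_on F W"
    and G: "continuous_on W' G" "G ` W' = W"
    and GF: "\<And>x. x \<in> W \<Longrightarrow> G (F x) = x" and FG: "\<And>y. y \<in> W' \<Longrightarrow> F (G y) = y"
    using hom by (auto simp: homeomorphism_def intro: inj_on_inverseI)
  have 1: "\<exists>U. openin (top_of_set X) U \<and> x \<in> U \<and> top_of_set U homeomorphic_space Euclidean_space d"
    if Fx: "F x \<in> rel_interior D"
  proof -
    obtain e where e: "e > 0" "ball (F x) e \<inter> A \<subseteq> D"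
      using Fx unfolding mem_rel_interior_ball A_def by blast
    define O' where "O' = A \<inter> ball (F x) e"
    have opO: "openin (top_of_set A) O'"
      unfolding O'_def by (simp add: openin_open_Int)
    have OD: "O' \<subseteq> rel_interior D"
      using e opO by (intro rel_interior_maximal) (auto simp: O'_def A_def)
    then have OW: "O' \<subseteq> W'" using D(2) by blast
    have FxA: "F x \<in> A" using Fx DA rel_interior_subset by blast
    have "openin (top_of_set W') O'"
      using opO OW D(3) DA by (meson openin_subset_trans order_trans)
    then have "openin (top_of_set W) (G ` O')"
      using hom homeomorphism_imp_open_map homeomorphism_symD by blast
    then have op: "openin (top_of_set X) (G ` O')"
      using W openin_trans by blast
    have "x \<in> G ` O'"
      using GF[OF x] FxA e by (intro image_eqI[of _ _ "F x"]) (auto simp: O'_def)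
    moreover have "G ` O' homeomorphic O'"
    proof -
      have "homeomorphism (G ` O') O' F G"
        using FG OW G(2) by (intro homeomorphism_of_subsets[OF hom]) (auto simp: image_image subset_iff)
      then show ?thesis by (auto simp: homeomorphic_def)
    qed
    then have "G ` O' homeomorphic A"
      using affine_Int_ball_homeomorphic[OF A(1) FxA e(1)] homeomorphic_trans unfolding O'_def by blast
    then have "top_of_set (G ` O') homeomorphic_space Euclidean_space d"
      using affine_homeomorphic_Euclidean_space[OF A] homeomorphic_imp_homeomorphic_space
        homeomorphic_space_trans by blast
    ultimately show ?thesis using op by blast
  qed
  have 2: "F x \<in> rel_interior D"
    if U: "openin (top_of_set X) U" "x \<in> U" "top_of_set U homeomorphic_space Euclidean_space d" for U
  proof -
    have "top_of_set U homeomorphic_space top_of_set A"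
      using U(3) affine_homeomorphic_Euclidean_space[OF A] homeomorphic_space_sym homeomorphic_space_trans
      by blast
    then obtain h k where hk: "homeomorphism U A h k"
      using homeomorphic_space_imp_homeomorphism by blast
    have UW: "openin (top_of_set U) (U \<inter> W)"
      using W U(1) openin_imp_subset by (metis inf_le1 openin_Int openin_subset_trans)
    then have opA: "openin (top_of_set A) (h ` (U \<inter> W))"
      using hk homeomorphism_imp_open_map by blast
    have k: "continuous_on A k" "\<And>y. y \<in> U \<Longrightarrow> k (h y) = y" "h ` U = A"
      using hk by (auto simp: homeomorphism_def)
    have khW: "k ` h ` (U \<inter> W) = U \<inter> W" using k(2) by force
    have "openin (top_of_set A) ((F \<circ> k) ` h ` (U \<inter> W))"
    proof (rule invariance_of_domain_affine_sets[OF opA A(1) A(1)])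
      show "continuous_on (h ` (U \<inter> W)) (F \<circ> k)"
        using khW k F(1) by (intro continuous_on_compose) (auto intro: continuous_on_subset)
      show "F \<circ> k \<in> h ` (U \<inter> W) \<rightarrow> A"
        using k(2) F(2) D(3) DA by fastforce
      show "inj_on (F \<circ> k) (h ` (U \<inter> W))"
        using k(2) F(3) by (auto simp: inj_on_def)
    qed simp
    then have "openin (top_of_set A) (F ` (U \<inter> W))"
      by (simp only: image_comp[symmetric] khW)
    then have "F ` (U \<inter> W) \<subseteq> rel_interior D"
      using F(2) D(3) by (intro rel_interior_maximal) (auto simp: A_def)
    then show ?thesis using U(2) x by blast
  qed
  show ?thesis
    unfolding manifold_boundary_def using xX 1 2 by blast
qed

text \<open>Non-boundary points form an open subset of \<open>X\<close>, and \<open>S\<close> lies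
  in the closure of its relative interior.\<close>

lemma subset_manifold_boundary:
  fixes S X :: "'a::euclidean_space set"
  assumes "convex S" "S \<subseteq> X" "rel_interior S \<subseteq> manifold_boundary d X"
  shows "S \<subseteq> manifold_boundary d X"
proof
  fix x assume x: "x \<in> S"
  show "x \<in> manifold_boundary d X"
  proof (rule ccontr)
    assume "x \<notin> manifold_boundary d X"
    then obtain U where U: "openin (top_of_set X) U" "x \<in> U" "top_of_set U homeomorphic_space Euclidean_space d"
      using x assms(2) unfolding manifold_boundary_def by blast
    obtain V where V: "open V" "U = X \<inter> V" using U(1) by (auto simp: openin_open)
    have "x \<in> closure (rel_interior S)"
      using convex_closure_rel_interior[OF assms(1)] x closure_subset by blast
    then obtain y where y: "y \<in> rel_interior S" "y \<in> V"
      using U(2) V unfolding closure_iff_nhds_not_empty by blast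
    then have "y \<in> U" using V(2) assms(2) rel_interior_subset by blast
    then have "y \<notin> manifold_boundary d X" using U unfolding manifold_boundary_def by blast
    then show False using y assms(3) by blast
  qed
qed

section \<open>The Bernoulli weights\<close>

context
  fixes \<beta> :: "int \<Rightarrow> real"
  assumes beta: "\<And>n::nat. n \<ge> 1 \<Longrightarrow> \<beta> (int n - 2) = 4 * (2 ^ n - 1) * bernoulli n / real n"
begin

text \<open>Multiplication by z turns the weights into 4(b(2z) - b(z)), where b(z) = z / (e^z - 1):
  the factor 2^n is the substitution of 2z, and the division by n is absorbed in the
  factorial.\<close>

lemma beta_egf: "Abs_fps (\<lambda>m. \<beta> (int m - 1) / fact m) * (fps_exp 1 + 1) = - 4"
proof -
  define G where "G = Abs_fps (\<lambda>m. \<beta> (int m - 1) / fact m)"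
  define b where "b = Abs_fps (\<lambda>n. bernoulli n / fact n)"
  define E :: "real fps" where "E = fps_exp 1"
  have b: "b * (E - 1) = fps_X"
    using bernoulli_generating_function by (simp add: b_def E_def)
  have b2: "(b oo (fps_const 2 * fps_X)) * (E * E - 1) = 2 * fps_X"
  proof -
    have "(b oo (fps_const 2 * fps_X)) * ((E - 1) oo (fps_const 2 * fps_X))
        = fps_X oo (fps_const 2 * fps_X)"
      using arg_cong[OF b, of "\<lambda>f. f oo (fps_const 2 * fps_X)"]
      by (simp add: fps_compose_mult_distrib)
    moreover have "(E - 1) oo (fps_const 2 * fps_X) = E * E - 1"
      by (simp add: E_def fps_compose_sub_distrib flip: fps_exp_add_mult)
    ultimately show ?thesis by (simp add: numeral_fps_const)
  qed
  have XG: "fps_X * G = 4 * ((b oo (fps_const 2 * fps_X)) - b)"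
  proof (rule fps_ext)
    fix n show "fps_nth (fps_X * G) n = fps_nth (4 * ((b oo (fps_const 2 * fps_X)) - b)) n"
    proof (cases n)
      case 0 then show ?thesis by (simp add: b_def fps_compose_linear)
    next
      case (Suc m)
      have "\<beta> (int m - 1) = 4 * (2 ^ Suc m - 1) * bernoulli (Suc m) / real (Suc m)"
        using beta[of "Suc m"] by simp
      moreover have "fps_nth (b oo (fps_const 2 * fps_X)) (Suc m) = 2 ^ Suc m * fps_nth b (Suc m)"
        by simp
      ultimately show ?thesis
        by (simp add: Suc b_def G_def numeral_fps_const field_simps del: of_nat_Suc fps_nth_compose_linear)
    qed
  qed
  \<comment> \<open>Multiplying by z(e^z - 1) clears both denominators, since e^(2z) - 1 = (e^z -
    1)(e^z + 1); the factor is nonzero and is cancelled afterwards.\<close>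
  have "fps_X * (E - 1) * (G * (E + 1)) = (fps_X * G) * (E * E - 1)"
    by (simp add: algebra_simps)
  also have "\<dots> = 4 * ((b oo (fps_const 2 * fps_X)) * (E * E - 1) - (b * (E - 1)) * (E + 1))"
    unfolding XG by (simp add: algebra_simps)
  also have "\<dots> = fps_X * (E - 1) * (- 4)"
    unfolding b b2 by (simp add: algebra_simps)
  finally have "fps_X * (E - 1) * (G * (E + 1)) = fps_X * (E - 1) * (- 4)" .
  moreover have "E - 1 \<noteq> 0"
  proof
    assume "E - 1 = 0"
    with b show False by simp
  qed
  ultimately have "G * (E + 1) = - 4"
    by (simp only: mult_cancel_left) simp
  then show ?thesis unfolding G_def E_def .
qed

text \<open>Coefficients of e^z G(z) = G(-z), times n!. Here \<open>H\<close> is G(-z) and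
  \<open>F\<close> is e^(-z); multiplying H(F + 1) = -4 by \<open>E\<close> gives H(E + 1) = E G (E
  + 1).\<close>

lemma beta_binomial_reflection:
  "(\<Sum>m\<le>n. real (n choose m) * \<beta> (int m - 1)) = (-1) ^ n * \<beta> (int n - 1)"
proof -
  define G where "G = Abs_fps (\<lambda>m. \<beta> (int m - 1) / fact m)"
  define E :: "real fps" where "E = fps_exp 1"
  define H where "H = G oo (fps_const (-1) * fps_X)"
  define F :: "real fps" where "F = fps_exp (-1)"
  have EF: "E * F = 1"
    by (simp add: E_def F_def flip: fps_exp_add_mult)
  have G: "G * (E + 1) = - 4"
    using beta_egf by (simp add: G_def E_def)
  have "H * (F + 1) = - 4"
    using arg_cong[OF G, of "\<lambda>f. f oo (fps_const (-1) * fps_X)"]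
    by (simp add: fps_compose_mult_distrib H_def E_def F_def fps_compose_add_distrib
        fps_compose_uminus numeral_fps_const del: fps_const_neg)
  then have "E * (H * (F + 1)) = E * (G * (E + 1))"
    using G by simp
  moreover have "E * (H * (F + 1)) = H * (E * F) + H * E"
    by (simp add: algebra_simps)
  ultimately have "H * (E + 1) = (E * G) * (E + 1)"
    using EF by (simp add: algebra_simps)
  moreover have "E + 1 \<noteq> 0"
    using G by auto
  ultimately have "H = E * G" by simp
  then have "fps_nth (G * E) n = fps_nth H n" by (simp add: mult.commute)
  then have "(\<Sum>m\<le>n. \<beta> (int m - 1) / fact m * (1 / fact (n - m))) = (-1) ^ n * \<beta> (int n - 1) / fact n"
    by (simp add: H_def G_def E_def fps_mult_nth fps_compose_linear atLeast0AtMost del: fps_const_neg)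
  then have "fact n * (\<Sum>m\<le>n. \<beta> (int m - 1) / fact m * (1 / fact (n - m))) = (-1) ^ n * \<beta> (int n - 1)"
    by simp
  moreover have "fact n * (\<Sum>m\<le>n. \<beta> (int m - 1) / fact m * (1 / fact (n - m)))
      = (\<Sum>m\<le>n. real (n choose m) * \<beta> (int m - 1))"
    unfolding sum_distrib_left by (intro sum.cong refl) (simp add: binomial_fact)
  ultimately show ?thesis by simp
qed

text \<open>The reflection at \<open>Suc j\<close> with the summand m = 0 split off; that summand is
  beta(-1) = -2, read off from the constant coefficient 2 G(0) = -4.\<close>

lemma beta_recurrence:
  "(\<Sum>k\<le>j. real (Suc j choose Suc k) * \<beta> (int k)) + (-1) ^ j * \<beta> (int j) = 2"
proof -
  have "\<beta> (-1) = -2"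
    using arg_cong[OF beta_egf, of "\<lambda>f. fps_nth f 0"] by simp
  with beta_binomial_reflection[of "Suc j"] show ?thesis
    by (simp add: sum.atMost_Suc_shift del: sum.atMost_Suc)
qed

text \<open>Weight the k-th relation by beta(k) and exchange the sums. By the recurrence the inner
  sum is 2 - (-1)^j beta(j), and the squared sign disappears in front of beta(j).\<close>

lemma alternating_sum_eq_beta_sum:
  fixes f b :: "nat \<Rightarrow> real"
  assumes ds: "\<And>k. k \<le> d \<Longrightarrow> (\<Sum>j\<le>d. (-1) ^ j * real (Suc j choose Suc k) * f j) = f k - b k"
  shows "(\<Sum>j\<le>d. (-1) ^ j * f j) = (\<Sum>k\<le>d. \<beta> (int k) * (f k - 1 / 2 * b k))"
proof -
  have "(\<Sum>k\<le>d. \<beta> (int k) * (f k - b k))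
      = (\<Sum>k\<le>d. \<Sum>j\<le>d. \<beta> (int k) * ((-1) ^ j * real (Suc j choose Suc k) * f j))"
    using ds by (intro sum.cong refl) (simp add: sum_distrib_left[symmetric] del: binomial_Suc_Suc)
  also have "\<dots> = (\<Sum>j\<le>d. (-1) ^ j * f j * (\<Sum>k\<le>d. real (Suc j choose Suc k) * \<beta> (int k)))"
    by (subst sum.swap) (simp add: sum_distrib_left mult_ac del: binomial_Suc_Suc)
  also have "\<dots> = (\<Sum>j\<le>d. (-1) ^ j * f j * (2 - (-1) ^ j * \<beta> (int j)))"
  proof (intro sum.cong refl arg_cong2[where f="(*)"])
    fix j assume "j \<in> {..d}"
    then have "(\<Sum>k\<le>d. real (Suc j choose Suc k) * \<beta> (int k)) = (\<Sum>k\<le>j. real (Suc j choose Suc k) * \<beta> (int k))"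
      by (intro sum.mono_neutral_right) (auto simp: binomial_eq_0)
    then show "(\<Sum>k\<le>d. real (Suc j choose Suc k) * \<beta> (int k)) = 2 - (-1) ^ j * \<beta> (int j)"
      using beta_recurrence[of j] by simp
  qed
  also have "\<dots> = 2 * (\<Sum>j\<le>d. (-1) ^ j * f j) - (\<Sum>j\<le>d. \<beta> (int j) * f j)"
  proof -
    have *: "(-1) ^ j * f j * (2 - (-1) ^ j * \<beta> (int j)) = 2 * ((-1) ^ j * f j) - \<beta> (int j) * f j" for j
      by (cases "even j") (simp_all add: algebra_simps)
    show ?thesis unfolding * by (simp add: sum_subtractf sum_distrib_left)
  qed
  finally show ?thesis
    by (simp add: algebra_simps sum_subtractf sum.distrib flip: sum_divide_distrib)
qed

end

section \<open>Face numbers of PL manifolds\<close>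

text \<open>Uniqueness is used on both sides of \<open>f\<close>: before it, the star against the
  cone over the triangulation \<open>T\<close> adapted to \<open>f\<close>; after it, the images of
  the simplices of \<open>T\<close> against the given dissection of \<open>Q\<close>. The cone of
  \<open>f\<close> itself need not be piecewise linear on these cells for this.\<close>

lemma star_euler_transfer:
  fixes f :: "'a::euclidean_space \<Rightarrow> 'b::euclidean_space"
  assumes M: "simplicial_complex M" "{v} \<in> M"
    and f: "homeomorphism (\<Union>(vertex_link M v)) Q f g" "piecewise_linear_on (\<Union>(vertex_link M v)) f"
    and J: "dissection J c Q"
  shows "local_euler {S \<in> M. v \<in> S} (\<lambda>S. S) v = 1 - (\<Sum>j\<in>J. (-1) ^ nat (aff_dim (c j)))"
    and "z \<in> \<Union>(vertex_link M v) \<Longrightarrow> 0 < s \<Longrightarrow> s < 1 \<Longrightarrow>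
      local_euler {S \<in> M. v \<in> S} (\<lambda>S. S) (v + s *\<^sub>R (z - v)) = - local_euler J c (f z)"
proof -
  let ?L = "\<Union>(vertex_link M v)"
  obtain T where T: "simplicial_complex T" "\<Union>T = ?L" "\<And>S. S \<in> T \<Longrightarrow> affine_map_on S f"
    using f(2) by (auto simp: piecewise_linear_on_def)
  let ?I = "T - {{}}"
  have dT: "dissection ?I (\<lambda>S. S) ?L"
    using complex_dissection[OF T(1)] T(2) by simp
  have sub: "\<And>S. S \<in> ?I \<Longrightarrow> S \<subseteq> ?L" using T(2) by blast
  have cp: "cone_position v ?L" using vertex_link_cone_position[OF M] .
  have fL: "f ` ?L = Q" "inj_on f ?L"
    using f(1) unfolding homeomorphism_def by (blast, metis inj_on_inverseI)
  have af: "\<And>S. S \<in> ?I \<Longrightarrow> affine_map_on S f" using T(3) by blast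
  have im: "dissection ?I (\<lambda>S. f ` S) (f ` ?L)"
    "(\<Sum>S\<in>?I. (-1) ^ nat (aff_dim (f ` S)) :: int) = (\<Sum>S\<in>?I. (-1) ^ nat (aff_dim S))"
    "\<And>z. z \<in> ?L \<Longrightarrow> local_euler ?I (\<lambda>S. f ` S) (f z) = local_euler ?I (\<lambda>S. S) z"
    using dissection_image[OF dT _ fL(2)] sub af by blast+
  have dQ: "dissection ?I (\<lambda>S. f ` S) Q" using im(1) fL(1) by simp
  have star: "local_euler {S \<in> M. v \<in> S} (\<lambda>S. S) x
      = local_euler (insert None (Some ` ?I)) (cone_cell v (\<lambda>S. S)) x" for x
    using local_euler_unique[OF star_dissection[OF M] dissection_cone[OF dT cp]] .
  have "local_euler (insert None (Some ` ?I)) (cone_cell v (\<lambda>S. S)) v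
      = 1 - (\<Sum>S\<in>?I. (-1) ^ nat (aff_dim S))"
    using local_euler_cone(1)[OF dT cp] sub by blast
  then show "local_euler {S \<in> M. v \<in> S} (\<lambda>S. S) v = 1 - (\<Sum>j\<in>J. (-1) ^ nat (aff_dim (c j)))"
    using star[of v] im(2) dissection_euler_unique[OF dQ J] by linarith
  assume z: "z \<in> ?L" and s: "0 < s" "s < 1"
  have "local_euler (insert None (Some ` ?I)) (cone_cell v (\<lambda>S. S)) (v + s *\<^sub>R (z - v))
      = - local_euler ?I (\<lambda>S. S) z"
    using local_euler_cone(2)[OF dT cp _ z s(1) less_imp_le[OF s(2)]] sub by blast
  then show "local_euler {S \<in> M. v \<in> S} (\<lambda>S. S) (v + s *\<^sub>R (z - v)) = - local_euler J c (f z)"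
    using star im(3)[OF z] local_euler_unique[OF dQ J, of "f z"] by simp
qed

text \<open>Invariance of dimension. It bounds the simplices of a manifold, whose definition
  constrains only the links of vertices.\<close>

lemma aff_dim_le_of_embedding:
  fixes F :: "'a::euclidean_space \<Rightarrow> 'b::euclidean_space"
  assumes S: "convex S" "S \<noteq> {}" "rel_interior S \<subseteq> W" and F: "homeomorphism W W' F G" "W' \<subseteq> D"
  shows "aff_dim S \<le> aff_dim D"
proof -
  have "aff_dim (affine hull S) \<le> aff_dim (affine hull D)"
  proof (rule invariance_of_dimension_affine_sets[of _ "rel_interior S" _ F])
    show "continuous_on (rel_interior S) F"
      using F(1) S(3) continuous_on_subset homeomorphism_cont1 by blast
    show "F \<in> rel_interior S \<rightarrow> affine hull D"
      using F S(3) hull_subset[of D affine] homeomorphism_image1 by blast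
    show "inj_on F (rel_interior S)"
      using F(1) S(3) by (meson homeomorphism_apply1 inj_on_inverseI subsetD)
  qed (use S in \<open>auto simp: openin_rel_interior rel_interior_eq_empty\<close>)
  then show ?thesis by simp
qed

text \<open>The model sphere bounds a \<open>d\<close>-simplex \<open>D\<close>, and coning from an
  interior point makes \<open>rel_interior D\<close> a chart without boundary points. The counts
  agree: 1 - (1 - (-1)^d) at the apex and -(-((-1)^d)) elsewhere.\<close>

lemma star_of_sphere_link:
  fixes M :: "'a::euclidean_space set set"
  assumes M: "simplicial_complex M" "{v} \<in> M" and sph: "pl_sphere (int d - 1) (vertex_link M v)"
  shows "x \<in> open_cone v (\<Union>(vertex_link M v)) \<Longrightarrow> local_euler {S \<in> M. v \<in> S} (\<lambda>S. S) x
      = (if x \<in> manifold_boundary d (\<Union>M) then 0 else (-1) ^ d)"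
    and "S \<in> M \<Longrightarrow> v \<in> S \<Longrightarrow> aff_dim S \<le> int d"
proof -
  let ?L = "\<Union>(vertex_link M v)"
  obtain D :: "'a set" where D: "int d simplex D" and "pl_homeomorphic ?L (rel_frontier D)"
    using sph by (auto simp: pl_sphere_def)
  then obtain f g where f: "homeomorphism ?L (rel_frontier D) f g" "piecewise_linear_on ?L f"
    by (auto simp: pl_homeomorphic_def)
  have cD: "convex D" "compact D" using D convex_simplex compact_simplex by blast+
  have dimD: "aff_dim D = int d" using D aff_dim_simplex by blast
  then have "D \<noteq> {}" by auto
  then obtain p where p: "p \<in> rel_interior D" using cD rel_interior_eq_empty by blast
  have cL: "compact ?L" using sph complex_compact by (auto simp: pl_sphere_def)
  obtain F G where F: "homeomorphism (open_cone v ?L) (rel_interior D) F G"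
    using cone_homeomorphism[OF vertex_link_cone_position[OF M] cone_rel_frontier(1)[OF cD p] cL f(1)]
      cone_rel_frontier(2)[OF cD p] by metis
  show "aff_dim S \<le> int d" if "S \<in> M" "v \<in> S"
  proof -
    have "rel_interior S \<subseteq> open_cone v ?L"
      using star_dissection[OF M] that unfolding dissection_def by blast
    moreover have "convex S" using complex_polytope[OF M(1)] that polytope_imp_convex by blast
    ultimately show ?thesis
      using aff_dim_le_of_embedding[OF _ _ _ F rel_interior_subset] that dimD by force
  qed
  assume x: "x \<in> open_cone v ?L"
  have "x \<notin> manifold_boundary d (\<Union>M)"
    using manifold_boundary_chart[OF openin_star[OF M] F dimD order_refl rel_interior_subset x]
      homeomorphism_image1[OF F] x by blast
  moreover
  note fr = euler_simplex_frontier[OF D of_nat_0_le_iff]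
  note tr = star_euler_transfer[OF M f fr(1)]
  consider "x = v" | s y where "x = v + s *\<^sub>R (y - v)" "0 < s" "s < 1" "y \<in> ?L"
    using x by (auto simp: open_cone_def)
  then have "local_euler {S \<in> M. v \<in> S} (\<lambda>S. S) x = (-1) ^ d"
  proof cases
    case 1
    then show ?thesis using tr(1) fr(2) by simp
  next
    case 2
    then have "f y \<in> rel_frontier D" using homeomorphism_image1[OF f(1)] by blast
    then show ?thesis using tr(2)[OF 2(4,2,3)] fr(3) 2(1) by simp
  qed
  ultimately show "local_euler {S \<in> M. v \<in> S} (\<lambda>S. S) x
      = (if x \<in> manifold_boundary d (\<Union>M) then 0 else (-1) ^ d)" by simp
qed

text \<open>The chart is a cone with apex on its frontier. The apex has sum 1 - 1 = 0; a point on
  the ray through \<open>y\<close> has minus the local sum of the ball at \<open>f y\<close>, which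
  vanishes exactly when \<open>f y\<close> lies on the relative frontier.\<close>

lemma star_of_ball_link:
  fixes M :: "'a::euclidean_space set set"
  assumes M: "simplicial_complex M" "{v} \<in> M" and ball: "pl_ball (int d - 1) (vertex_link M v)"
  shows "x \<in> open_cone v (\<Union>(vertex_link M v)) \<Longrightarrow> local_euler {S \<in> M. v \<in> S} (\<lambda>S. S) x
      = (if x \<in> manifold_boundary d (\<Union>M) then 0 else (-1) ^ d)"
    and "S \<in> M \<Longrightarrow> v \<in> S \<Longrightarrow> aff_dim S \<le> int d"
proof -
  let ?L = "\<Union>(vertex_link M v)"
  obtain B :: "'a set" where B: "(int d - 1) simplex B" and "pl_homeomorphic ?L B"
    using ball by (auto simp: pl_ball_def)
  then obtain f g where f: "homeomorphism ?L B f g" "piecewise_linear_on ?L f"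
    by (auto simp: pl_homeomorphic_def)
  have d: "int d - 1 \<ge> 0" using ball by (simp add: pl_ball_def)
  have cB: "convex B" using B convex_simplex by blast
  have dimB: "aff_dim B = int d - 1" using B aff_dim_simplex by blast
  then have Bne: "B \<noteq> {}" using d by auto
  have cL: "compact ?L" using ball complex_compact by (auto simp: pl_ball_def)
  let ?o = "(0, 0) :: 'a \<times> real"
  \<comment> \<open>Lifting the ball to height 1 in a product with the line puts it in cone position
    with respect to the origin.\<close>
  let ?Q = "B \<times> {1::real}"
  define D where "D = convex hull (insert ?o ?Q)"
  have cpo: "cone_position ?o ?Q" by (auto simp: cone_position_def)
  have cQ: "convex ?Q" "?Q \<noteq> {}" using cB Bne by (auto simp: convex_Times)
  have riQ: "rel_interior ?Q = rel_interior B \<times> {1}" using cB by (simp add: rel_interior_Times)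
  have riD: "rel_interior D = {?o + t *\<^sub>R (y - ?o) |t y. 0 < t \<and> t < 1 \<and> y \<in> rel_interior ?Q}"
    unfolding D_def by (rule rel_interior_convex_hull_insert_cone[OF cQ])
  have D_eq: "D = {?o + t *\<^sub>R (y - ?o) |t y. 0 \<le> t \<and> t \<le> 1 \<and> y \<in> ?Q}"
    unfolding D_def by (rule convex_hull_insert_cone[OF cQ])
  have "aff_dim ?Q = aff_dim B"
  proof -
    have "compact B" using B compact_simplex by blast
    moreover have "homeomorphism ?Q B fst (\<lambda>x. (x, 1))"
      by (intro homeomorphismI) (auto intro!: continuous_intros)
    ultimately show ?thesis
      using homeomorphic_convex_compact_sets_eq[of ?Q B] cQ cB
      by (auto simp: homeomorphic_def compact_Times)
  qed
  then have dimD: "aff_dim D = int d"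
    using aff_dim_convex_hull_insert[OF cpo cQ(1) order_refl] dimB by (simp add: D_def)
  have riD_sub: "rel_interior D \<subseteq> open_cone ?o ?Q"
    unfolding riD open_cone_def using rel_interior_subset[of ?Q] by blast
  have W'D: "open_cone ?o ?Q \<subseteq> D"
  proof
    fix y assume "y \<in> open_cone ?o ?Q"
    then consider "y = ?o" | t z where "y = ?o + t *\<^sub>R (z - ?o)" "0 < t" "t < 1" "z \<in> ?Q"
      unfolding open_cone_def by blast
    then show "y \<in> D"
    proof cases
      case 1
      then show ?thesis by (simp add: D_def hull_inc)
    next
      case 2
      then show ?thesis unfolding D_eq using less_imp_le by blast
    qed
  qed
  have f': "homeomorphism ?L ?Q (\<lambda>y. (f y, 1)) (\<lambda>y. g (fst y))"
    using f(1) unfolding homeomorphism_def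
    by (auto intro!: continuous_intros continuous_on_compose2[of B g _ fst] simp: image_iff)
  obtain F G where F: "homeomorphism (open_cone v ?L) (open_cone ?o ?Q) F G" "F v = ?o"
    "\<And>y t. y \<in> ?L \<Longrightarrow> 0 < t \<Longrightarrow> t < 1 \<Longrightarrow> F (v + t *\<^sub>R (y - v)) = ?o + t *\<^sub>R ((f y, 1) - ?o)"
    using cone_homeomorphism[OF vertex_link_cone_position[OF M] cpo cL f'] by metis
  show "aff_dim S \<le> int d" if "S \<in> M" "v \<in> S"
  proof -
    have "rel_interior S \<subseteq> open_cone v ?L"
      using star_dissection[OF M] that unfolding dissection_def by blast
    moreover have "convex S" using complex_polytope[OF M(1)] that polytope_imp_convex by blast
    ultimately show ?thesis
      using aff_dim_le_of_embedding[OF _ _ _ F(1) W'D] that dimD by force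
  qed
  assume x: "x \<in> open_cone v ?L"
  have bd: "x \<in> manifold_boundary d (\<Union>M) \<longleftrightarrow> F x \<notin> rel_interior D"
    by (rule manifold_boundary_chart[OF openin_star[OF M] F(1) dimD riD_sub W'D x])
  note fc = dissection_faces[OF simplex_imp_polytope[OF B]] euler_simplex[OF B d]
  note tr = star_euler_transfer[OF M f fc(1)]
  consider "x = v" | s y where "x = v + s *\<^sub>R (y - v)" "0 < s" "s < 1" "y \<in> ?L"
    using x by (auto simp: open_cone_def)
  then show "local_euler {S \<in> M. v \<in> S} (\<lambda>S. S) x
      = (if x \<in> manifold_boundary d (\<Union>M) then 0 else (-1) ^ d)"
  proof cases
    case 1
    \<comment> \<open>Points of the relative interior of \<open>D\<close> have positive height,
      whereas the apex has height 0.\<close>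
    have "F x \<notin> rel_interior D" using 1 F(2) by (auto simp: riD riQ)
    then show ?thesis using tr(1) fc(2) 1 bd by simp
  next
    case 2
    have "F x = s *\<^sub>R (f y, 1)" using F(3)[OF 2(4,2,3)] 2(1) by simp
    \<comment> \<open>The height of \<open>F x\<close> is \<open>s\<close>, so the cone parameter
      must be \<open>s\<close> and the base point must be \<open>f y\<close>.\<close>
    then have iff: "F x \<in> rel_interior D \<longleftrightarrow> f y \<in> rel_interior B"
      using 2(2,3) by (auto simp: riD riQ)
    have "f y \<in> B" using 2(4) homeomorphism_image1[OF f(1)] by blast
    then have "local_euler {S \<in> M. v \<in> S} (\<lambda>S. S) x
        = - (if f y \<in> rel_interior B then (-1) ^ nat (int d - 1) else 0)"
      using tr(2)[OF 2(4,2,3)] fc(3) 2(1) by simp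
    moreover have "d = Suc (nat (int d - 1))" using d by linarith
    then have "(-1 :: int) ^ d = - ((-1) ^ nat (int d - 1))" by (metis power_Suc mult_minus1)
    ultimately show ?thesis using bd iff by simp
  qed
qed

section \<open>Counting incident pairs of faces in a PL manifold\<close>

context
  fixes M :: "'a::euclidean_space set set" and d :: nat
  assumes man: "pl_manifold d M"
begin

lemma pl_manifold_complex: "simplicial_complex M"
  using man by (simp add: pl_manifold_def)

lemma star_euler:
  assumes "{v} \<in> M" "x \<in> open_cone v (\<Union>(vertex_link M v))"
  shows "local_euler {S \<in> M. v \<in> S} (\<lambda>S. S) x
      = (if x \<in> manifold_boundary d (\<Union>M) then 0 else (-1) ^ d)"
  using man assms star_of_sphere_link(1) star_of_ball_link(1) unfolding pl_manifold_def by blast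

lemma aff_dim_manifold_simplex:
  assumes "S \<in> M"
  shows "aff_dim S \<le> int d"
proof (cases "S = {}")
  case False
  then obtain v where "v \<in> S" "{v} \<in> M" using simplex_vertex[OF pl_manifold_complex] assms by blast
  then show ?thesis
    using man assms star_of_sphere_link(2) star_of_ball_link(2) unfolding pl_manifold_def by blast
qed simp

text \<open>For \<open>x\<close> in the relative interior of \<open>S\<close>, the simplices through
  \<open>x\<close> are the cofaces of \<open>S\<close>, so this is a local sum in the star of any
  vertex of \<open>S\<close>. If \<open>S\<close> is not contained in the boundary, such an
  \<open>x\<close> can be chosen off the boundary.\<close>

lemma sum_cofaces:
  assumes S: "S \<in> M" "S \<noteq> {}"
  shows "(\<Sum>R | R \<in> M \<and> S \<subseteq> R. (-1) ^ nat (aff_dim R) :: int)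
    = (if S \<subseteq> manifold_boundary d (\<Union>M) then 0 else (-1) ^ d)"
proof -
  let ?B = "manifold_boundary d (\<Union>M)"
  have cv: "convex S" using complex_polytope[OF pl_manifold_complex S(1)] polytope_imp_convex by blast
  obtain v where v: "v \<in> S" "{v} \<in> M" using simplex_vertex[OF pl_manifold_complex S] .
  have *: "(\<Sum>R | R \<in> M \<and> S \<subseteq> R. (-1) ^ nat (aff_dim R)) = (if x \<in> ?B then 0 else (-1 :: int) ^ d)"
    if x: "x \<in> rel_interior S" for x
  proof -
    have "{R \<in> {R \<in> M. v \<in> R}. x \<in> R} = {R. R \<in> M \<and> S \<subseteq> R}"
      using complex_carrier_subset[OF pl_manifold_complex S(1) _ x] v(1) x rel_interior_subset by blast
    moreover have "x \<in> open_cone v (\<Union>(vertex_link M v))"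
      using star_dissection[OF pl_manifold_complex v(2)] x v(1) S(1) unfolding dissection_def by blast
    ultimately show ?thesis using star_euler[OF v(2), of x] unfolding local_euler_def by metis
  qed
  show ?thesis
  proof (cases "S \<subseteq> ?B")
    case True
    obtain x where "x \<in> rel_interior S" using cv S(2) rel_interior_eq_empty by blast
    then show ?thesis using * True rel_interior_subset by (metis subsetD)
  next
    case False
    then obtain x where "x \<in> rel_interior S" "x \<notin> ?B"
      using subset_manifold_boundary[OF cv, of "\<Union>M"] S(1) by blast
    then show ?thesis using * False by simp
  qed
qed

lemma f_num_eq_0_above: "n > d \<Longrightarrow> f_num n M = 0"
proof -
  assume "n > d"
  then have "\<not> int n simplex S" if "S \<in> M" for S
    using aff_dim_manifold_simplex[OF that] aff_dim_simplex[of "int n" S] by auto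
  then have "{S \<in> M. int n simplex S} = {}" by blast
  then show ?thesis unfolding f_num_def by (simp only: card.empty)
qed

text \<open>Count the pairs of a \<open>k\<close>-face \<open>S\<close> contained in a face
  \<open>R\<close> with sign (-1)^dim(R). Grouping by \<open>R\<close> gives binomials, since a
  \<open>j\<close>-simplex has \<open>Suc j\<close> vertices; grouping by \<open>S\<close> gives
  coface sums, which are 1 or 0 as \<open>d\<close> is even.\<close>

lemma dehn_sommerville:
  assumes "even d"
  shows "(\<Sum>j\<le>d. (-1) ^ j * int (Suc j choose Suc k) * int (f_num j M))
    = int (f_num k M) - int (f_num k (boundary_complex d M))"
proof -
  let ?B = "manifold_boundary d (\<Union>M)"
  let ?M = "\<lambda>k. {S \<in> M. int k simplex S}"
  have finM: "finite M" using complex_finite[OF pl_manifold_complex] .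
  \<comment> \<open>The empty simplex is removed: its dimension -1 would be truncated to 0 by
    \<open>nat\<close> and count with sign +1.\<close>
  have part: "M - {{}} = (\<Union>j\<in>{..d}. ?M j)"
  proof (intro set_eqI iffI)
    fix S assume S: "S \<in> M - {{}}"
    then obtain n where n: "n simplex S" using complex_simplex[OF pl_manifold_complex] by blast
    have "aff_dim S = n" using n aff_dim_simplex by blast
    then have "0 \<le> n" "n \<le> int d"
      using S aff_dim_manifold_simplex[of S] aff_dim_negative_iff[of S] by auto
    then show "S \<in> (\<Union>j\<in>{..d}. ?M j)" using n S by (intro UN_I[of "nat n"]) auto
  qed (auto)
  have "(\<Sum>j\<le>d. (-1) ^ j * int (Suc j choose Suc k) * int (f_num j M))
      = (\<Sum>j\<le>d. \<Sum>R\<in>?M j. (-1) ^ nat (aff_dim R) * int (card {S \<in> M. int k simplex S \<and> S \<subseteq> R}))"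
  proof (intro sum.cong refl)
    fix j
    have "(\<Sum>R\<in>?M j. (-1) ^ nat (aff_dim R) * int (card {S \<in> M. int k simplex S \<and> S \<subseteq> R}))
        = (\<Sum>R\<in>?M j. (-1) ^ j * int (Suc j choose Suc k))"
      using card_simplex_faces[OF pl_manifold_complex] aff_dim_simplex by (intro sum.cong refl) fastforce
    then show "(-1) ^ j * int (Suc j choose Suc k) * int (f_num j M)
        = (\<Sum>R\<in>?M j. (-1) ^ nat (aff_dim R) * int (card {S \<in> M. int k simplex S \<and> S \<subseteq> R}))"
      by (simp add: f_num_def)
  qed
  also have "\<dots> = (\<Sum>R\<in>M - {{}}. (-1) ^ nat (aff_dim R) * int (card {S \<in> M. int k simplex S \<and> S \<subseteq> R}))"
    unfolding part using finM
    by (intro sum.UNION_disjoint[symmetric]) (auto dest!: aff_dim_simplex)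
  also have "\<dots> = (\<Sum>R\<in>M - {{}}. \<Sum>S\<in>{S \<in> ?M k. S \<subseteq> R}. (-1) ^ nat (aff_dim R))"
    by (intro sum.cong refl) (simp add: conj_ac)
  also have "\<dots> = (\<Sum>S\<in>?M k. \<Sum>R | R \<in> M - {{}} \<and> S \<subseteq> R. (-1) ^ nat (aff_dim R))"
    using finM by (subst sum.swap_restrict) auto
  also have "\<dots> = (\<Sum>S\<in>?M k. if S \<subseteq> ?B then 0 else 1)"
  proof (intro sum.cong refl)
    fix S assume S: "S \<in> ?M k"
    then have ne: "S \<noteq> {}" by auto
    then have "{R. R \<in> M - {{}} \<and> S \<subseteq> R} = {R. R \<in> M \<and> S \<subseteq> R}" by blast
    then show "(\<Sum>R | R \<in> M - {{}} \<and> S \<subseteq> R. (-1) ^ nat (aff_dim R)) = (if S \<subseteq> ?B then 0 else 1 :: int)"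
      using sum_cofaces[OF _ ne] S \<open>even d\<close> by simp
  qed
  also have "\<dots> = int (card (?M k - {S \<in> ?M k. S \<subseteq> ?B}))"
  proof -
    have "(\<Sum>S\<in>?M k. if S \<subseteq> ?B then 0 else 1 :: int) = (\<Sum>S\<in>?M k - {S \<in> ?M k. S \<subseteq> ?B}. 1)"
      using finM by (intro sum.mono_neutral_cong_right) auto
    then show ?thesis by simp
  qed
  also have "\<dots> = int (card (?M k)) - int (card {S \<in> ?M k. S \<subseteq> ?B})"
    using finM by (subst card_Diff_subset) (auto intro!: of_nat_diff card_mono)
  also have "{S \<in> ?M k. S \<subseteq> ?B} = {S \<in> boundary_complex d M. int k simplex S}"
    by (auto simp: boundary_complex_def)
  finally show ?thesis by (simp add: f_num_def)
qed

text \<open>The definition stops at the ambient dimension and the formula at \<open>d\<close>; both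
  sums are extended by zeros to the larger bound.\<close>

lemma euler_char_eq_sum: "euler_char M = (\<Sum>n\<le>d. (-1) ^ n * int (f_num n M))"
proof -
  have "euler_char M = (\<Sum>n\<le>max d (DIM('a)). (-1) ^ n * int (f_num n M))"
    unfolding euler_char_def
    by (intro sum.mono_neutral_left) (auto simp: not_le f_num_eq_0)
  also have "\<dots> = (\<Sum>n\<le>d. (-1) ^ n * int (f_num n M))"
    by (intro sum.mono_neutral_right) (auto simp: not_le f_num_eq_0_above)
  finally show ?thesis .
qed

end

theorem corollary1:
  fixes M :: "'a::euclidean_space set set" and d :: nat and \<beta> :: "int \<Rightarrow> real"
  assumes "pl_manifold d M"
    and "even d"
    and "\<And>n::nat. n \<ge> 1 \<Longrightarrow> \<beta> (int n - 2) = 4 * (2 ^ n - 1) * bernoulli n / real n"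
  shows "real_of_int (euler_char M) =
    (\<Sum>n=0..d. \<beta> (int n) * (real (f_num n M) - 1 / 2 * real (f_num n (boundary_complex d M))))"
proof -
  have "(\<Sum>j\<le>d. (-1) ^ j * real (Suc j choose Suc k) * real (f_num j M))
      = real (f_num k M) - real (f_num k (boundary_complex d M))" for k
    using arg_cong[OF dehn_sommerville[OF assms(1,2), of k], of real_of_int]
    by (simp del: binomial_Suc_Suc)
  then have "(\<Sum>j\<le>d. (-1) ^ j * real (f_num j M))
      = (\<Sum>k\<le>d. \<beta> (int k) * (real (f_num k M) - 1 / 2 * real (f_num k (boundary_complex d M))))"
    by (intro alternating_sum_eq_beta_sum[OF assms(3)])
  then show ?thesis
    by (simp add: euler_char_eq_sum[OF assms(1)] atLeast0AtMost)
qed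

end
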